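(* There is a parallel algorithm (in the parallel model described in the context, with as many processors as needed) with the following guarantee. For all integers $m,k\ge 1$ and every kernel $W\in\mathbb{R}^{k\times k}$ with $W_{(k,k)}=1$, let $(y,W)\mapsto x=\mathrm{inv\text{-}conv}_W(y)$ be the inverse of the $k\times k$ convolution with top-left zero padding on $m\times m$ single-channel images, and let $L$ be a differentiable real-valued loss that depends on $(y,W)$ only through $x$. Given as input the kernel $W$, the output $x\in\mathbb{R}^{m^2}$ and the gradient $\frac{\partial L}{\partial x}\in\mathbb{R}^{m^2}$ at that $x$, the algorithm computes both the input gradient $\frac{\partial L}{\partial y}\in\mathbb{R}^{m^2}$ and the weight gradient $\frac{\partial L}{\partial W}\in\mathbb{R}^{k^2}$ in parallel running time $O(mk^2)$. (In terms of the number of pixels $n=m^2$, for constant $k$ this is $O(\sqrt{n})$.)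
   Context: Images are single-channel $m\times m$ arrays, regarded as vectors in $\mathbb{R}^{m^2}$ indexed by pixels $p=(p_1,p_2)\in\{1,\dots,m\}^2$. The kernel $W\in\mathbb{R}^{k\times k}$ is indexed by $\{1,\dots,k\}^2$ and its bottom-right entry is fixed: $W_{(k,k)}=1$. For a pixel $p$ let $$\Delta(p)=\{(i,j)\in\{1,\dots,m\}^2 : 0\le p_1-i<k,\ 0\le p_2-j<k\}\setminus\{p\}.$$ The convolution $y=\mathrm{conv}_W(x)$ with $k-1$ zeros padded on the top and left of $x$ is $$y_p=x_p+\sum_{q\in\Delta(p)}W_{(k,k)-p+q}\,x_q\qquad\text{for every pixel }p.$$ For given $y$ and $W$ this linear system has a unique solution $x$, denoted $x=\mathrm{inv\text{-}conv}_W(y)$; thus $y$ is the input and $x$ the output of the inverse of convolution. The gradients $\frac{\partial L}{\partial y}$ and $\frac{\partial L}{\partial W}$ are the gradients of $(y,W)\mapsto L(\mathrm{inv\text{-}conv}_W(y))$ with respect to $y$ (with $W$ fixed) and with respect to the entries of $W$ (with $y$ fixed). The entry $W_{(k,k)}$ does not appear in the displayed formula, so the corresponding component of $\frac{\partial L}{\partial W}$ is $0$. Parallel model: synchronous processors with shared memory (as in a PRAM), as many of them as needed, each performing one exact real arithmetic operation or one memory access per unit of time; the running time is the number of parallel time steps. The constant in $O(mk^2)$ is absolute. *)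

theory Defs
  imports "HOL-Analysis.Analysis"
begin

section \<open>Images, kernels and the inverse of convolution\<close>

definition square :: "nat \<Rightarrow> (nat \<times> nat) set" where
  "square n = {1..n} \<times> {1..n}"

text \<open>The space of real \<open>n \<times> n\<close> arrays is represented by extensional functions, so that arrays
  of all sizes share one type and two arrays are equal iff their entries are. It is used both for
  images (\<open>n = m\<close>) and for kernels (\<open>n = k\<close>).\<close>

definition arrays :: "nat \<Rightarrow> (nat \<times> nat \<Rightarrow> real) set" where
  "arrays n = square n \<rightarrow>\<^sub>E UNIV"

definition neighbours :: "nat \<Rightarrow> nat \<Rightarrow> nat \<times> nat \<Rightarrow> (nat \<times> nat) set" where
  "neighbours m k p =
     {(i, j) \<in> square m. i \<le> fst p \<and> fst p - i < k \<and> j \<le> snd p \<and> snd p - j < k} - {p}"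

text \<open>For \<open>q \<in> neighbours m k p\<close> the natural-number subtractions in the kernel index
  \<open>(k, k) - p + q\<close> do not truncate.\<close>

definition conv :: "nat \<Rightarrow> nat \<Rightarrow> (nat \<times> nat \<Rightarrow> real) \<Rightarrow> (nat \<times> nat \<Rightarrow> real) \<Rightarrow> (nat \<times> nat \<Rightarrow> real)" where
  "conv m k W x = (\<lambda>p\<in>square m.
     x p + (\<Sum>q\<in>neighbours m k p. W (k + fst q - fst p, k + snd q - snd p) * x q))"

definition inv_conv :: "nat \<Rightarrow> nat \<Rightarrow> (nat \<times> nat \<Rightarrow> real) \<Rightarrow> (nat \<times> nat \<Rightarrow> real) \<Rightarrow> (nat \<times> nat \<Rightarrow> real)" where
  "inv_conv m k W y = (THE x. x \<in> arrays m \<and> conv m k W x = y)"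

lemma neighbours_less:
  assumes "q \<in> neighbours m k p"
  shows "q \<in> square m" "fst q + snd q < fst p + snd p"
  using assms unfolding neighbours_def by (auto simp: prod_eq_iff)

lemma conv_ex1:
  assumes y: "y \<in> arrays m"
  shows "\<exists>!x. x \<in> arrays m \<and> conv m k W x = y"
proof -
  let ?S = "\<lambda>x p. \<Sum>q\<in>neighbours m k p. W (k + fst q - fst p, k + snd q - snd p) * x q"
  have ex: "\<exists>x. \<forall>p\<in>square m. fst p + snd p < d \<longrightarrow> x p + ?S x p = y p" for d :: nat
  proof (induction d)
    case (Suc d)
    then obtain x where x: "\<forall>p\<in>square m. fst p + snd p < d \<longrightarrow> x p + ?S x p = y p" by blast
    define x' where "x' = (\<lambda>p. if fst p + snd p < d then x p else y p - ?S x p)"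
    have S: "?S x' p = ?S x p" if "fst p + snd p < Suc d" for p
      using that by (intro sum.cong refl) (auto simp: x'_def dest: neighbours_less(2))
    have "x' p + ?S x' p = y p" if "p \<in> square m" "fst p + snd p < Suc d" for p
      using x that S[OF that(2)] by (cases "fst p + snd p < d") (auto simp: x'_def)
    then show ?case by blast
  qed simp
  obtain x where x: "\<forall>p\<in>square m. fst p + snd p < 2 * m + 1 \<longrightarrow> x p + ?S x p = y p"
    using ex by blast
  have x: "x p + ?S x p = y p" if "p \<in> square m" for p
    using x that by (auto simp: square_def)
  have eq: "?S (restrict x (square m)) p = ?S x p" for p
    by (intro sum.cong refl) (simp add: neighbours_less(1))
  have "conv m k W (restrict x (square m)) = y"
  proof
    fix p show "conv m k W (restrict x (square m)) p = y p"
      using x[of p] y PiE_arb[of y "square m" "\<lambda>_. UNIV" p] unfolding conv_def eq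
      by (cases "p \<in> square m") (auto simp: arrays_def)
  qed
  moreover have "restrict x (square m) \<in> arrays m" by (simp add: arrays_def)
  moreover have "u = v" if u: "u \<in> arrays m" "conv m k W u = y" and v: "v \<in> arrays m" "conv m k W v = y"
    for u v
  proof -
    have *: "p \<in> square m \<Longrightarrow> u p = v p" for p
    proof (induction "fst p + snd p" arbitrary: p rule: less_induct)
      case less
      have "?S u p = ?S v p"
        by (intro sum.cong refl) (simp add: less.hyps neighbours_less)
      moreover have "u p + ?S u p = y p" "v p + ?S v p = y p"
        using fun_cong[OF u(2), of p] fun_cong[OF v(2), of p] less.prems by (auto simp: conv_def)
      ultimately show ?case by linarith
    qed
    show ?thesis
      using u(1) v(1) unfolding arrays_def by (rule PiE_ext) (rule *)
  qed
  ultimately show ?thesis by blast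
qed


section \<open>Gradients on finite-dimensional function spaces\<close>

text \<open>Frechet differentiability, with gradient \<open>g\<close>, of a function on the Euclidean space of real
  vectors indexed by the finite set \<open>I\<close>. The index set is a term rather than a type because the
  dimension is quantified inside the theorem; the lemma below identifies the notion with
  \<open>has_derivative\<close>.\<close>

definition has_gradient ::
  "'i set \<Rightarrow> (('i \<Rightarrow> real) \<Rightarrow> real) \<Rightarrow> ('i \<Rightarrow> real) \<Rightarrow> ('i \<Rightarrow> real) \<Rightarrow> bool" where
  "has_gradient I f g x \<longleftrightarrow>
     (\<forall>\<epsilon>>0. \<exists>\<delta>>0. \<forall>z \<in> I \<rightarrow>\<^sub>E UNIV. L2_set (\<lambda>i. z i - x i) I < \<delta> \<longrightarrow>
        \<bar>f z - f x - (\<Sum>i\<in>I. g i * (z i - x i))\<bar> \<le> \<epsilon> * L2_set (\<lambda>i. z i - x i) I)"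

lemma has_gradient_iff_has_derivative:
  fixes f :: "('n::finite \<Rightarrow> real) \<Rightarrow> real" and g x :: "real ^ 'n"
  shows "has_gradient UNIV f (vec_nth g) (vec_nth x) \<longleftrightarrow>
    ((\<lambda>v. f (vec_nth v)) has_derivative (\<lambda>h. g \<bullet> h)) (at x)"
proof -
  have all: "(\<forall>z::'n \<Rightarrow> real. Q z) \<longleftrightarrow> (\<forall>v::real^'n. Q (vec_nth v))" for Q
    by (metis vec_lambda_inverse UNIV_I)
  show ?thesis
    unfolding has_gradient_def has_derivative_at_alt
    by (simp add: all bounded_linear_inner_right norm_vec_def L2_set_def inner_vec_def)
qed


section \<open>Synchronous parallel random access machine on the reals\<close>

text \<open>All processors run the same finite program in lockstep, each on its own program counter and
  its own registers. Every executed instruction takes one time step, including loading a constant,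
  comparisons and jumps. Shared memory has concurrent reads and exclusive writes. Memory addresses
  are register contents that are natural numbers. Program constants are integers, so
  that no information can be encoded in a real constant.\<close>

datatype binop = Add | Sub | Mul | Div | Leq

datatype instr =
    Const nat int           \<comment> \<open>\<open>Const r c\<close>: \<open>r := c\<close>\<close>
  | ProcId nat              \<comment> \<open>\<open>ProcId r\<close>: \<open>r :=\<close> index of the executing processor\<close>
  | Op binop nat nat nat    \<comment> \<open>\<open>Op b r s t\<close>: \<open>r := s b t\<close>\<close>
  | Load nat nat            \<comment> \<open>\<open>Load r s\<close>: \<open>r := memory[s]\<close>\<close>
  | Store nat nat           \<comment> \<open>\<open>Store s r\<close>: \<open>memory[s] := r\<close>\<close>
  | JumpNZ nat nat          \<comment> \<open>\<open>JumpNZ r l\<close>: if \<open>r \<noteq> 0\<close> continue at instruction \<open>l\<close>\<close>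

type_synonym memory = "nat \<Rightarrow> real"
type_synonym processor = "nat \<times> (nat \<Rightarrow> real)"
type_synonym config = "(nat \<Rightarrow> processor) \<times> memory"

fun apply_op :: "binop \<Rightarrow> real \<Rightarrow> real \<Rightarrow> real" where
  "apply_op Add a b = a + b"
| "apply_op Sub a b = a - b"
| "apply_op Mul a b = a * b"
| "apply_op Div a b = a / b"
| "apply_op Leq a b = (if a \<le> b then 1 else 0)"

definition address :: "real \<Rightarrow> nat" where
  "address v = nat \<lfloor>v\<rfloor>"

fun exec_instr :: "memory \<Rightarrow> nat \<Rightarrow> instr \<Rightarrow> processor \<Rightarrow> processor" where
  "exec_instr M i (Const r c) (pc, R) = (pc + 1, R(r := of_int c))"
| "exec_instr M i (ProcId r) (pc, R) = (pc + 1, R(r := real i))"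
| "exec_instr M i (Op b r s t) (pc, R) = (pc + 1, R(r := apply_op b (R s) (R t)))"
| "exec_instr M i (Load r s) (pc, R) = (pc + 1, R(r := M (address (R s))))"
| "exec_instr M i (Store s r) (pc, R) = (pc + 1, R)"
| "exec_instr M i (JumpNZ r l) (pc, R) = (if R r \<noteq> 0 then l else pc + 1, R)"

text \<open>Absence of faults: no division by zero, and only natural numbers as addresses.\<close>

fun instr_ok :: "instr \<Rightarrow> (nat \<Rightarrow> real) \<Rightarrow> bool" where
  "instr_ok (Op b r s t) R \<longleftrightarrow> (b = Div \<longrightarrow> R t \<noteq> 0)"
| "instr_ok (Load r s) R \<longleftrightarrow> R s \<in> \<nat>"
| "instr_ok (Store s r) R \<longleftrightarrow> R s \<in> \<nat>"
| "instr_ok _ R \<longleftrightarrow> True"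

definition halted :: "instr list \<Rightarrow> processor \<Rightarrow> bool" where
  "halted prog P \<longleftrightarrow> fst P \<ge> length prog"

definition write_request :: "instr list \<Rightarrow> processor \<Rightarrow> (nat \<times> real) option" where
  "write_request prog P =
     (if halted prog P then None
      else case prog ! fst P of
             Store s r \<Rightarrow> Some (address (snd P s), snd P r)
           | _ \<Rightarrow> None)"

text \<open>The configuration consists of processors \<open>0, \<dots>, n - 1\<close> and the shared memory (the states of
  processors with index at least \<open>n\<close> are irrelevant). A step is legal if no processor faults and
  no two processors write to the same cell.\<close>

definition step_ok :: "instr list \<Rightarrow> nat \<Rightarrow> config \<Rightarrow> bool" where
  "step_ok prog n c \<longleftrightarrow>
     (\<forall>i<n. \<not> halted prog (fst c i) \<longrightarrow> instr_ok (prog ! fst (fst c i)) (snd (fst c i))) \<and>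
     (\<forall>i<n. \<forall>j<n. \<forall>a v w. i \<noteq> j \<longrightarrow> write_request prog (fst c i) = Some (a, v) \<longrightarrow>
        write_request prog (fst c j) \<noteq> Some (a, w))"

text \<open>Reads in a step see the memory before the writes of that step.\<close>

definition step :: "instr list \<Rightarrow> nat \<Rightarrow> config \<Rightarrow> config" where
  "step prog n c =
     ((\<lambda>i. if halted prog (fst c i) then fst c i
           else exec_instr (snd c) i (prog ! fst (fst c i)) (fst c i)),
      (\<lambda>a. if \<exists>i<n. \<exists>v. write_request prog (fst c i) = Some (a, v)
           then THE v. \<exists>i<n. write_request prog (fst c i) = Some (a, v)
           else snd c a))"

definition init_config :: "memory \<Rightarrow> config" where
  "init_config M = ((\<lambda>i. (0, \<lambda>r. 0)), M)"

text \<open>\<open>runs_to prog n M t M'\<close>: started on memory \<open>M\<close> with \<open>n\<close> processors, all processors have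
  halted after \<open>t\<close> legal steps, leaving memory \<open>M'\<close>.\<close>

definition runs_to :: "instr list \<Rightarrow> nat \<Rightarrow> memory \<Rightarrow> nat \<Rightarrow> memory \<Rightarrow> bool" where
  "runs_to prog n M t M' \<longleftrightarrow>
     (\<forall>s<t. step_ok prog n ((step prog n ^^ s) (init_config M))) \<and>
     (\<forall>i<n. halted prog (fst ((step prog n ^^ t) (init_config M)) i)) \<and>
     snd ((step prog n ^^ t) (init_config M)) = M'"


section \<open>Input and output conventions\<close>

text \<open>The memory initially holds \<open>m\<close>, \<open>k\<close>, then the kernel, the output \<open>x\<close> of the inverse of
  convolution and the gradient with respect to \<open>x\<close>, each in row-major order, and zeros after
  that. The two results are expected, again in row-major order, right behind the input.\<close>

definition indices :: "nat \<Rightarrow> (nat \<times> nat) list" where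
  "indices n = List.product [1..<n + 1] [1..<n + 1]"

definition input_list ::
  "nat \<Rightarrow> nat \<Rightarrow> (nat \<times> nat \<Rightarrow> real) \<Rightarrow> (nat \<times> nat \<Rightarrow> real) \<Rightarrow> (nat \<times> nat \<Rightarrow> real) \<Rightarrow> real list" where
  "input_list m k W x g =
     [real m, real k] @ map W (indices k) @ map x (indices m) @ map g (indices m)"

definition input_memory ::
  "nat \<Rightarrow> nat \<Rightarrow> (nat \<times> nat \<Rightarrow> real) \<Rightarrow> (nat \<times> nat \<Rightarrow> real) \<Rightarrow> (nat \<times> nat \<Rightarrow> real) \<Rightarrow> memory" where
  "input_memory m k W x g a =
     (if a < length (input_list m k W x g) then input_list m k W x g ! a else 0)"

definition read_array :: "nat \<Rightarrow> nat \<Rightarrow> memory \<Rightarrow> (nat \<times> nat \<Rightarrow> real)" where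
  "read_array base n M = (\<lambda>p\<in>square n. M (base + (fst p - 1) * n + (snd p - 1)))"

definition output_y :: "nat \<Rightarrow> nat \<Rightarrow> memory \<Rightarrow> (nat \<times> nat \<Rightarrow> real)" where
  "output_y m k M = read_array (2 + k\<^sup>2 + 2 * m\<^sup>2) m M"

definition output_W :: "nat \<Rightarrow> nat \<Rightarrow> memory \<Rightarrow> (nat \<times> nat \<Rightarrow> real)" where
  "output_W m k M = read_array (2 + k\<^sup>2 + 3 * m\<^sup>2) k M"

end

theory Submission
  imports Defs
begin

text \<open>Write the convolution as \<open>x \<mapsto> x + lower W x\<close>, with \<open>lower W\<close> strictly lower triangular
  along the antidiagonals of the image. The input gradient is the solution of the transposed system
  \<open>l + upper W l = g\<close>, and the Jacobi iteration \<open>l \<mapsto> g - upper W l\<close> reaches it exactly after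
  \<open>2 m\<close> rounds because the triangular part is nilpotent. With one processor per pixel a round takes
  \<open>O(k\<^sup>2)\<close> steps. Each of the \<open>k\<^sup>2\<close> weight derivatives is a sum over all pixels of
  \<open>- l p * x q\<close> with \<open>p - q\<close> fixed, evaluated in \<open>O(m)\<close> steps by summing all rows in parallel
  and then the row sums. All loops have the same trip counts on all processors, so the processors
  never leave lockstep.\<close>

section \<open>Lockstep execution of structured programs\<close>

text \<open>Both gradients come from one duality: a perturbation \<open>h\<close> of the output
  solves \<open>h + lower W h = r\<close>, and pairing \<open>h\<close> with \<open>g\<close> equals
  pairing \<open>l\<close> with \<open>r\<close>. Perturbing the input makes \<open>r\<close> the
  change of \<open>y\<close>; perturbing the kernel by \<open>D\<close> makes it
  \<open>- lower D x\<close> up to second order. Back substitution along antidiagonals would need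
  about as many rounds, but different processors would be active at different times. Jacobi
  iteration repeats work in exchange for control flow that is the same on every processor. The same
  concern shapes the loop bodies: image borders are masked by a factor 0, the fixed kernel entry is
  treated like any other and compensated, and row indices are found by counting. Since every
  processor executes every store and writes are exclusive, each one needs its own target cell; hence
  the private copies of the weight result.\<close>

datatype com = Block "instr list" | Seq com com (infixr ";;" 60) | Loop com nat

text \<open>Jump targets are absolute, so the code depends on the position \<open>l\<close> where it
  is placed. A loop tests after its body and thus runs at least once, which suits
  \<open>m \<ge> 1\<close> and \<open>k \<ge> 1\<close>.\<close>

fun compile :: "nat \<Rightarrow> com \<Rightarrow> instr list" where
  "compile l (Block is) = is"
| "compile l (c ;; d) = compile l c @ compile (l + length (compile l c)) d"
| "compile l (Loop c r) = compile l c @ [JumpNZ r l]"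

section \<open>Execution segments and timed Hoare rules\<close>

definition reaches :: "instr list \<Rightarrow> nat \<Rightarrow> nat \<Rightarrow> config \<Rightarrow> config \<Rightarrow> bool" where
  "reaches prog n t c c' \<longleftrightarrow>
     (\<forall>s<t. step_ok prog n ((step prog n ^^ s) c)) \<and> c' = (step prog n ^^ t) c"

lemma reaches_refl: "reaches prog n 0 c c"
  by (simp add: reaches_def)

lemma reaches_step: "step_ok prog n c \<Longrightarrow> reaches prog n 1 c (step prog n c)"
  by (simp add: reaches_def)

lemma reaches_trans:
  assumes "reaches prog n t c c'" "reaches prog n t' c' c''"
  shows "reaches prog n (t + t') c c''"
proof -
  have funpow: "(step prog n ^^ (s + t)) c = (step prog n ^^ s) c'" for s
    using assms(1) by (simp add: reaches_def funpow_add)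
  have "step_ok prog n ((step prog n ^^ s) c)" if "s < t + t'" for s
  proof (cases "s < t")
    case False
    then show ?thesis
      using that assms(2) funpow[of "s - t"] by (simp add: reaches_def)
  qed (use assms(1) in \<open>simp add: reaches_def\<close>)
  moreover have "c'' = (step prog n ^^ (t + t')) c"
    using assms(2) funpow[of t'] by (simp add: reaches_def add.commute)
  ultimately show ?thesis
    by (simp add: reaches_def)
qed

text \<open>All processors are at the same instruction; \<open>Q\<close> describes the memory and \<open>P i\<close> the
  registers of processor \<open>i\<close>.\<close>

definition lockstep ::
  "nat \<Rightarrow> nat \<Rightarrow> (memory \<Rightarrow> bool) \<Rightarrow> (nat \<Rightarrow> (nat \<Rightarrow> real) \<Rightarrow> bool) \<Rightarrow> config \<Rightarrow> bool" where
  "lockstep n pc Q P c \<longleftrightarrow> Q (snd c) \<and> (\<forall>i<n. fst (fst c i) = pc \<and> P i (snd (fst c i)))"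

definition code_at :: "instr list \<Rightarrow> nat \<Rightarrow> instr list \<Rightarrow> bool" where
  "code_at prog l is \<longleftrightarrow> (\<exists>xs ys. prog = xs @ is @ ys \<and> length xs = l)"

lemma code_at_append:
  "code_at prog l (is @ js) \<Longrightarrow> code_at prog l is"
  "code_at prog l (is @ js) \<Longrightarrow> code_at prog (l + length is) js"
  unfolding code_at_def by (auto, metis append.assoc length_append)

lemma code_at_Cons:
  assumes "code_at prog l (i # is)"
  shows "prog ! l = i" "l < length prog" "code_at prog (Suc l) is"
proof -
  obtain xs ys where "prog = xs @ i # is @ ys" "length xs = l"
    using assms by (auto simp: code_at_def)
  then show "prog ! l = i" "l < length prog"
    by auto
  show "code_at prog (Suc l) is"
    using assms code_at_append(2)[of prog l "[i]" "is"] by simp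
qed

text \<open>A Hoare triple for total correctness with a time bound. Quantifying over all programs
  that contain the code at \<open>l\<close> makes the rules compositional in spite of absolute jump
  targets.\<close>

definition valid ::
  "nat \<Rightarrow> (memory \<Rightarrow> bool) \<Rightarrow> (nat \<Rightarrow> (nat \<Rightarrow> real) \<Rightarrow> bool) \<Rightarrow> com \<Rightarrow> nat \<Rightarrow>
   (memory \<Rightarrow> bool) \<Rightarrow> (nat \<Rightarrow> (nat \<Rightarrow> real) \<Rightarrow> bool) \<Rightarrow> bool" where
  "valid n Q P c t Q' P' \<longleftrightarrow>
     (\<forall>prog l s. code_at prog l (compile l c) \<longrightarrow> lockstep n l Q P s \<longrightarrow>
        (\<exists>t'\<le>t. \<exists>s'. reaches prog n t' s s' \<and> lockstep n (l + length (compile l c)) Q' P' s'))"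

lemma valid_weaken:
  assumes "valid n Q P c t Q' P'"
    and "\<And>M. Q0 M \<Longrightarrow> Q M" "\<And>i R. i < n \<Longrightarrow> P0 i R \<Longrightarrow> P i R"
    and "t \<le> t1" "\<And>M. Q' M \<Longrightarrow> Q1 M" "\<And>i R. i < n \<Longrightarrow> P' i R \<Longrightarrow> P1 i R"
  shows "valid n Q0 P0 c t1 Q1 P1"
proof -
  have "lockstep n l Q P s" if "lockstep n l Q0 P0 s" for l s
    using that assms(2,3) by (auto simp: lockstep_def)
  moreover have "lockstep n l Q1 P1 s" if "lockstep n l Q' P' s" for l s
    using that assms(5,6) by (auto simp: lockstep_def)
  ultimately show ?thesis
    using assms(1,4) unfolding valid_def by (meson order_trans)
qed

lemma valid_Seq:
  assumes "valid n Q P c t Q' P'" "valid n Q' P' d u Q'' P''"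
  shows "valid n Q P (c ;; d) (t + u) Q'' P''"
  unfolding valid_def
proof (intro allI impI)
  fix prog l s
  assume code: "code_at prog l (compile l (c ;; d))" and s: "lockstep n l Q P s"
  let ?l = "l + length (compile l c)"
  have code: "code_at prog l (compile l c)" "code_at prog ?l (compile ?l d)"
    using code by (auto dest: code_at_append)
  obtain t' s' where 1: "t' \<le> t" "reaches prog n t' s s'" "lockstep n ?l Q' P' s'"
    using assms(1) code(1) s unfolding valid_def by blast
  obtain u' s'' where 2: "u' \<le> u" "reaches prog n u' s' s''"
      "lockstep n (?l + length (compile ?l d)) Q'' P'' s''"
    using assms(2) code(2) 1(3) unfolding valid_def by blast
  show "\<exists>t'\<le>t + u. \<exists>s'. reaches prog n t' s s' \<and> lockstep n (l + length (compile l (c ;; d))) Q'' P'' s'"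
    using 1(1) 2(1,3) reaches_trans[OF 1(2) 2(2)]
    by (intro exI[of _ "t' + u'"] conjI exI[of _ s'']) (simp_all add: add.assoc)
qed

text \<open>The outcome of the test depends on the round but not on the processor, so the closing
  jump takes all processors to the same instruction. Assertions are indexed by the number of
  finished rounds; the extra step per round pays for the jump.\<close>

lemma valid_Loop:
  assumes N: "1 \<le> N"
    and body: "\<And>j. j < N \<Longrightarrow> valid n (Q j) (P j) c t (Q (Suc j)) (P (Suc j))"
    and test: "\<And>j i R. 1 \<le> j \<Longrightarrow> j \<le> N \<Longrightarrow> i < n \<Longrightarrow> P j i R \<Longrightarrow> R r \<noteq> 0 \<longleftrightarrow> j < N"
  shows "valid n (Q 0) (P 0) (Loop c r) (N * (t + 1)) (Q N) (P N)"
  unfolding valid_def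
proof (intro allI impI)
  fix prog l s
  assume code: "code_at prog l (compile l (Loop c r))" and s: "lockstep n l (Q 0) (P 0) s"
  let ?j = "l + length (compile l c)" and ?e = "l + length (compile l (Loop c r))"
  have body_code: "code_at prog l (compile l c)" and "code_at prog ?j [JumpNZ r l]"
    using code by (auto dest: code_at_append)
  then have jump: "prog ! ?j = JumpNZ r l" "?j < length prog" "?e = Suc ?j"
    using code_at_Cons by auto
  \<comment> \<open>Induction on the number \<open>d\<close> of remaining rounds; \<open>d\<close>
    is at least 1 because the body precedes the test.\<close>
  have "\<exists>t'\<le>d * (t + 1). \<exists>s'. reaches prog n t' s s' \<and> lockstep n ?e (Q N) (P N) s'"
    if "1 \<le> d" "d + j = N" "lockstep n l (Q j) (P j) s" for d j s
    using that
  proof (induction d arbitrary: j s)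
    case (Suc d)
    obtain t1 s1 where 1: "t1 \<le> t" "reaches prog n t1 s s1" "lockstep n ?j (Q (Suc j)) (P (Suc j)) s1"
      using body[of j] body_code Suc.prems unfolding valid_def by (metis add_Suc add_leD2 not_less_eq_eq not_le)
    have pc: "fst (fst s1 i) = ?j" if "i < n" for i
      using 1(3) that by (simp add: lockstep_def)
    have no_write: "write_request prog (fst s1 i) = None" if "i < n" for i
      using pc[OF that] jump by (simp add: write_request_def)
    have "step_ok prog n s1"
      using pc jump no_write by (simp add: step_ok_def)
    then have 2: "reaches prog n (t1 + 1) s (step prog n s1)"
      using 1(2) reaches_trans reaches_step by blast
    have mem: "snd (step prog n s1) = snd s1"
      using no_write by (auto simp: step_def fun_eq_iff)
    have reg: "fst (step prog n s1) i = (if Suc j < N then l else ?e, snd (fst s1 i))" if "i < n" for i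
    proof -
      have "snd (fst s1 i) r \<noteq> 0 \<longleftrightarrow> Suc j < N"
        using 1(3) that test[of "Suc j" i] Suc.prems by (simp add: lockstep_def)
      then show ?thesis
        using pc[OF that] jump by (cases "fst s1 i") (auto simp: step_def halted_def)
    qed
    have ls: "lockstep n (if Suc j < N then l else ?e) (Q (Suc j)) (P (Suc j)) (step prog n s1)"
      using 1(3) unfolding lockstep_def by (simp add: mem reg)
    show ?case
    proof (cases "Suc j < N")
      case True
      then obtain t2 s2 where 3: "t2 \<le> d * (t + 1)" "reaches prog n t2 (step prog n s1) s2"
          "lockstep n ?e (Q N) (P N) s2"
        using Suc.IH[of "Suc j" "step prog n s1"] Suc.prems ls by auto
      show ?thesis
        using reaches_trans[OF 2 3(2)] 3(1,3) 1(1)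
        by (intro exI[of _ "t1 + 1 + t2"] conjI exI[of _ s2]) auto
    next
      case False
      then have "Suc j = N"
        using Suc.prems by simp
      then show ?thesis
        using False 2 ls 1(1)
        by (intro exI[of _ "t1 + 1"] conjI exI[of _ "step prog n s1"]) auto
    qed
  qed simp
  from this[of N 0 s] N s
  show "\<exists>t'\<le>N * (t + 1). \<exists>s'. reaches prog n t' s s' \<and> lockstep n ?e (Q N) (P N) s'"
    by simp
qed

section \<open>Straight-line code and exclusive writes\<close>

fun local_instr :: "instr \<Rightarrow> bool" where
  "local_instr (Store s r) \<longleftrightarrow> False"
| "local_instr (JumpNZ r l) \<longleftrightarrow> False"
| "local_instr _ \<longleftrightarrow> True"

fun exec_block :: "memory \<Rightarrow> nat \<Rightarrow> instr list \<Rightarrow> (nat \<Rightarrow> real) \<Rightarrow> (nat \<Rightarrow> real)" where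
  "exec_block M i [] R = R"
| "exec_block M i (a # as) R = exec_block M i as (snd (exec_instr M i a (0, R)))"

fun block_ok :: "memory \<Rightarrow> nat \<Rightarrow> instr list \<Rightarrow> (nat \<Rightarrow> real) \<Rightarrow> bool" where
  "block_ok M i [] R \<longleftrightarrow> True"
| "block_ok M i (a # as) R \<longleftrightarrow>
     local_instr a \<and> instr_ok a R \<and> block_ok M i as (snd (exec_instr M i a (0, R)))"

lemma exec_local_instr:
  "local_instr a \<Longrightarrow> exec_instr M i a (pc, R) = (Suc pc, snd (exec_instr M i a (0, R)))"
  by (cases a) auto

text \<open>Code that neither writes nor jumps leaves the memory fixed, so each processor evolves as
  a function of its own registers and the initial memory. Verifying a block amounts to evaluating
  \<open>exec_block\<close>.\<close>

lemma valid_Block: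
  assumes "length is \<le> t"
    and "\<And>M i R. Q M \<Longrightarrow> i < n \<Longrightarrow> P i R \<Longrightarrow> block_ok M i is R \<and> P' i (exec_block M i is R)"
  shows "valid n Q P (Block is) t Q P'"
  unfolding valid_def
proof (intro allI impI)
  fix prog l s
  assume code: "code_at prog l (compile l (Block is))" and s: "lockstep n l Q P s"
  have "\<exists>s'. reaches prog n (length is) s s' \<and> snd s' = snd s \<and>
      (\<forall>i<n. fst s' i = (l + length is, exec_block (snd s) i is (snd (fst s i))))"
    if "code_at prog l is" "\<forall>i<n. fst (fst s i) = l \<and> block_ok (snd s) i is (snd (fst s i))" for l s
    using that
  proof (induction "is" arbitrary: l s)
    case Nil
    have "fst s i = (l, snd (fst s i))" if "i < n" for i
      using Nil that by (metis prod.collapse)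
    then show ?case
      by (intro exI[of _ s]) (simp add: reaches_refl)
  next
    case (Cons a as)
    have a: "prog ! l = a" "l < length prog" "code_at prog (Suc l) as"
      using code_at_Cons[OF Cons.prems(1)] by auto
    have loc: "local_instr a" if "i < n" for i
      using Cons.prems(2) that by auto
    have no_write: "write_request prog (fst s i) = None" if "i < n" for i
      using Cons.prems(2) that a loc[OF that] by (cases a) (auto simp: write_request_def)
    have ok: "step_ok prog n s"
      using Cons.prems(2) a no_write by (simp add: step_ok_def)
    have mem: "snd (step prog n s) = snd s"
      using no_write by (auto simp: step_def fun_eq_iff)
    have reg: "fst (step prog n s) i = (Suc l, snd (exec_instr (snd s) i a (0, snd (fst s i))))" if "i < n" for i
      using Cons.prems(2) a that exec_local_instr[OF loc[OF that], of "snd s" i l]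
      by (cases "fst s i") (auto simp: step_def halted_def)
    obtain s' where s': "reaches prog n (length as) (step prog n s) s'" "snd s' = snd s"
      "\<forall>i<n. fst s' i = (Suc l + length as, exec_block (snd s) i as (snd (fst (step prog n s) i)))"
      using Cons.IH[OF a(3), of "step prog n s"] Cons.prems(2) reg mem by auto
    show ?case
      using reaches_trans[OF reaches_step[OF ok] s'(1)] s'(2,3) reg by (intro exI[of _ s']) auto
  qed
  note * = this[of l s]
  have "code_at prog l is" "\<forall>i<n. fst (fst s i) = l \<and> block_ok (snd s) i is (snd (fst s i))"
    using code s assms(2) by (auto simp: lockstep_def)
  from *[OF this] obtain s' where s': "reaches prog n (length is) s s'" "snd s' = snd s"
      "\<forall>i<n. fst s' i = (l + length is, exec_block (snd s) i is (snd (fst s i)))"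
    by blast
  then have "lockstep n (l + length is) Q P' s'"
    using s assms(2) by (auto simp: lockstep_def)
  with s'(1) assms(1) show "\<exists>t'\<le>t. \<exists>s'. reaches prog n t' s s' \<and>
      lockstep n (l + length (compile l (Block is))) Q P' s'"
    by (intro exI[of _ "length is"] conjI exI[of _ s']) simp_all
qed

lemma address_of_nat [simp]: "address (real a) = a"
  by (simp add: address_def)

text \<open>Injectivity of \<open>ad\<close> is the exclusive-write condition. The new memory is
  described completely, on and off the written cells, so that frame conditions can be derived where
  the rule is used.\<close>

lemma valid_Store:
  assumes regs: "\<And>i R. i < n \<Longrightarrow> P i R \<Longrightarrow> R s = real (ad i) \<and> R r = val i"
    and inj: "inj_on ad {..<n}"
    and mem: "\<And>M M'. Q M \<Longrightarrow> \<forall>i<n. M' (ad i) = val i \<Longrightarrow>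
      \<forall>a. a \<notin> ad ` {..<n} \<longrightarrow> M' a = M a \<Longrightarrow> Q' M'"
  shows "valid n Q P (Block [Store s r]) 1 Q' P"
  unfolding valid_def
proof (intro allI impI)
  fix prog l c
  assume code: "code_at prog l (compile l (Block [Store s r]))" and c: "lockstep n l Q P c"
  have a: "prog ! l = Store s r" "l < length prog"
    using code code_at_Cons by auto
  have pc: "fst (fst c i) = l" "snd (fst c i) s = real (ad i)" "snd (fst c i) r = val i" if "i < n" for i
    using c that regs by (auto simp: lockstep_def)
  have req: "write_request prog (fst c i) = Some (ad i, val i)" if "i < n" for i
    using pc[OF that] a by (simp add: write_request_def halted_def)
  have "step_ok prog n c"
    using pc a req inj by (auto simp: step_ok_def inj_on_def)
  then have step: "reaches prog n 1 c (step prog n c)"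
    by (rule reaches_step)
  have reg: "fst (step prog n c) i = (Suc l, snd (fst c i))" if "i < n" for i
    using pc[OF that] a by (cases "fst c i") (auto simp: step_def halted_def)
  have "snd (step prog n c) (ad i) = val i" if "i < n" for i
  proof -
    have "(THE v. \<exists>j<n. write_request prog (fst c j) = Some (ad i, v)) = val i"
      using that by (intro the_equality) (auto simp: req dest: inj_onD[OF inj])
    moreover have "\<exists>j<n. \<exists>v. write_request prog (fst c j) = Some (ad i, v)"
      using that req by blast
    ultimately show ?thesis
      by (simp add: step_def)
  qed
  moreover have "snd (step prog n c) a = snd c a" if "a \<notin> ad ` {..<n}" for a
    using that by (auto simp: step_def req)
  ultimately have "lockstep n (Suc l) Q' P (step prog n c)"
    using c mem[of "snd c" "snd (step prog n c)"] unfolding lockstep_def by (auto simp: reg)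
  with step show "\<exists>t'\<le>1. \<exists>s'. reaches prog n t' c s' \<and>
      lockstep n (l + length (compile l (Block [Store s r]))) Q' P s'"
    by (intro exI[of _ 1] conjI exI[of _ "step prog n c"]) simp_all
qed

lemma valid_runs_to:
  assumes "valid n Q P c t Q' P'" "Q M" "\<And>i. i < n \<Longrightarrow> P i (\<lambda>r. 0)"
  shows "\<exists>t'\<le>t. \<exists>M'. runs_to (compile 0 c) n M t' M' \<and> Q' M'"
proof -
  let ?p = "compile 0 c"
  have code: "code_at ?p 0 ?p"
    unfolding code_at_def by (intro exI[of _ "[]"]) simp
  have init: "lockstep n 0 Q P (init_config M)"
    using assms(2,3) by (simp add: lockstep_def init_config_def)
  obtain t' s' where "t' \<le> t" "reaches ?p n t' (init_config M) s'"
      "lockstep n (length ?p) Q' P' s'"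
    using assms(1)[unfolded valid_def, rule_format, OF code init] by auto
  then show ?thesis
    by (intro exI[of _ t'] exI[of _ "snd s'"] conjI)
      (auto simp: runs_to_def reaches_def lockstep_def halted_def)
qed

section \<open>The adjoint system and the two gradients\<close>

lemma finite_square [simp]: "finite (square n)"
  by (simp add: square_def)

definition offsets :: "nat \<Rightarrow> (nat \<times> nat) set" where
  "offsets k = square k - {(k, k)}"

lemma finite_offsets [simp]: "finite (offsets k)"
  by (simp add: offsets_def)

text \<open>The kernel entry \<open>e\<close> multiplies the input pixel \<open>q\<close> in the equation for the output
  pixel \<open>p\<close>, that is, \<open>e = (k, k) - p + q\<close>.\<close>

definition linked :: "nat \<Rightarrow> nat \<times> nat \<Rightarrow> nat \<times> nat \<Rightarrow> nat \<times> nat \<Rightarrow> bool" where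
  "linked k p q e \<longleftrightarrow> fst p + fst e = fst q + k \<and> snd p + snd e = snd q + k"

text \<open>The neighbour sum as a sum over all pairs with an indicator: the ranges no longer depend
  on \<open>p\<close>, so transposing, in the image or in the kernel argument, is an exchange of
  sums.\<close>

definition lower ::
  "nat \<Rightarrow> nat \<Rightarrow> (nat \<times> nat \<Rightarrow> real) \<Rightarrow> (nat \<times> nat \<Rightarrow> real) \<Rightarrow> nat \<times> nat \<Rightarrow> real" where
  "lower m k W h p = (\<Sum>q\<in>square m. \<Sum>e\<in>offsets k. of_bool (linked k p q e) * (W e * h q))"

definition upper ::
  "nat \<Rightarrow> nat \<Rightarrow> (nat \<times> nat \<Rightarrow> real) \<Rightarrow> (nat \<times> nat \<Rightarrow> real) \<Rightarrow> nat \<times> nat \<Rightarrow> real" where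
  "upper m k W l q = (\<Sum>p\<in>square m. \<Sum>e\<in>offsets k. of_bool (linked k p q e) * (W e * l p))"

lemma neighbours_sum:
  assumes p: "p \<in> square m"
  shows "(\<Sum>q\<in>neighbours m k p. W (k + fst q - fst p, k + snd q - snd p) * h q) = lower m k W h p"
proof -
  have "(\<Sum>e\<in>offsets k. of_bool (linked k p q e) * (W e * h q)) =
      (if q \<in> neighbours m k p then W (k + fst q - fst p, k + snd q - snd p) * h q else 0)"
    if q: "q \<in> square m" for q
  proof (cases "q \<in> neighbours m k p")
    case True
    let ?e = "(k + fst q - fst p, k + snd q - snd p)"
    have e: "?e \<in> offsets k" "\<And>e. linked k p q e \<longleftrightarrow> e = ?e"
      using True p q
      by (auto simp: neighbours_def offsets_def square_def linked_def prod_eq_iff)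
    have "(\<Sum>e\<in>offsets k. of_bool (linked k p q e) * (W e * h q)) =
        (\<Sum>e\<in>offsets k. if e = ?e then W e * h q else 0)"
      by (intro sum.cong refl) (simp add: e(2))
    then show ?thesis
      using True e(1) by simp
  next
    case False
    then have "\<not> linked k p q e" if "e \<in> offsets k" for e
      using that p q
      by (auto simp: neighbours_def offsets_def square_def linked_def prod_eq_iff)
    then show ?thesis
      using False by simp
  qed
  then have "lower m k W h p =
      (\<Sum>q\<in>square m. if q \<in> neighbours m k p then W (k + fst q - fst p, k + snd q - snd p) * h q else 0)"
    unfolding lower_def by (intro sum.cong refl)
  also have "\<dots> = (\<Sum>q\<in>square m \<inter> neighbours m k p. W (k + fst q - fst p, k + snd q - snd p) * h q)"
    by (simp add: sum.inter_restrict)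
  also have "square m \<inter> neighbours m k p = neighbours m k p"
    using neighbours_less(1) by blast
  finally show ?thesis ..
qed

lemma conv_lower: "p \<in> square m \<Longrightarrow> conv m k W x p = x p + lower m k W x p"
  by (simp add: conv_def neighbours_sum)

lemma inv_conv:
  assumes "y \<in> arrays m"
  shows "inv_conv m k W y \<in> arrays m"
    and "p \<in> square m \<Longrightarrow> inv_conv m k W y p + lower m k W (inv_conv m k W y) p = y p"
proof -
  have "inv_conv m k W y \<in> arrays m \<and> conv m k W (inv_conv m k W y) = y"
    unfolding inv_conv_def by (rule theI'[OF conv_ex1[OF assms]])
  then show "inv_conv m k W y \<in> arrays m"
    and "p \<in> square m \<Longrightarrow> inv_conv m k W y p + lower m k W (inv_conv m k W y) p = y p"
    using conv_lower[of p m k W "inv_conv m k W y"] by auto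
qed

lemma lower_diff: "lower m k W h p - lower m k W h' p = lower m k W (\<lambda>q. h q - h' q) p"
  by (simp add: lower_def sum_subtractf[symmetric] algebra_simps)

lemma lower_add: "lower m k W h p + lower m k W h' p = lower m k W (\<lambda>q. h q + h' q) p"
  by (simp add: lower_def sum.distrib[symmetric] algebra_simps)

lemma lower_kernel_diff: "lower m k W h p - lower m k W' h p = lower m k (\<lambda>e. W e - W' e) h p"
  by (simp add: lower_def sum_subtractf[symmetric] algebra_simps)

lemma lower_adjoint:
  "(\<Sum>p\<in>square m. l p * lower m k W h p) = (\<Sum>q\<in>square m. upper m k W l q * h q)"
proof -
  have "(\<Sum>p\<in>square m. l p * lower m k W h p) =
      (\<Sum>p\<in>square m. \<Sum>q\<in>square m. \<Sum>e\<in>offsets k. of_bool (linked k p q e) * (W e * l p) * h q)"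
    by (simp add: lower_def sum_distrib_left mult_ac del: sum_of_bool_mult_eq)
  also have "\<dots> =
      (\<Sum>q\<in>square m. \<Sum>p\<in>square m. \<Sum>e\<in>offsets k. of_bool (linked k p q e) * (W e * l p) * h q)"
    by (rule sum.swap)
  also have "\<dots> = (\<Sum>q\<in>square m. upper m k W l q * h q)"
    by (simp add: upper_def sum_distrib_right del: sum_of_bool_mult_eq)
  finally show ?thesis .
qed

section \<open>Solving the adjoint system\<close>

primrec jacobi ::
  "nat \<Rightarrow> nat \<Rightarrow> (nat \<times> nat \<Rightarrow> real) \<Rightarrow> (nat \<times> nat \<Rightarrow> real) \<Rightarrow> nat \<Rightarrow> nat \<times> nat \<Rightarrow> real" where
  "jacobi m k W g 0 = (\<lambda>q. 0)"
| "jacobi m k W g (Suc t) = (\<lambda>q. g q - upper m k W (jacobi m k W g t) q)"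

text \<open>\<open>upper\<close> at \<open>q\<close> only reads pixels on later antidiagonals, so the iterates settle one
  antidiagonal at a time.\<close>

lemma jacobi_stable:
  "q \<in> square m \<Longrightarrow> 2 * m < t + fst q + snd q \<Longrightarrow> jacobi m k W g (Suc t) q = jacobi m k W g t q"
proof (induction t arbitrary: q)
  case (Suc t)
  have "upper m k W (jacobi m k W g (Suc t)) q = upper m k W (jacobi m k W g t) q"
    unfolding upper_def
  proof (intro sum.cong refl)
    fix p e assume p: "p \<in> square m" and e: "e \<in> offsets k"
    have "2 * m < t + fst p + snd p" if "linked k p q e"
    proof -
      have "fst e \<le> k" "snd e \<le> k" "fst e + snd e < 2 * k"
        using e by (auto simp: offsets_def square_def)
      then show ?thesis
        using that Suc.prems by (auto simp: linked_def)
    qed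
    then show "of_bool (linked k p q e) * (W e * jacobi m k W g (Suc t) p) =
        of_bool (linked k p q e) * (W e * jacobi m k W g t p)"
      using Suc.IH[OF p] by (cases "linked k p q e") simp_all
  qed
  then show ?case
    by (simp only: jacobi.simps)
qed (auto simp: square_def)

definition adjoint_solution ::
  "nat \<Rightarrow> nat \<Rightarrow> (nat \<times> nat \<Rightarrow> real) \<Rightarrow> (nat \<times> nat \<Rightarrow> real) \<Rightarrow> nat \<times> nat \<Rightarrow> real" where
  "adjoint_solution m k W g = jacobi m k W g (2 * m)"

lemma adjoint_solution:
  assumes q: "q \<in> square m"
  shows "adjoint_solution m k W g q + upper m k W (adjoint_solution m k W g) q = g q"
proof -
  have "2 * m < 2 * m + fst q + snd q"
    using q by (auto simp: square_def)
  from jacobi_stable[OF q this, of k W g] show ?thesis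
    by (simp add: adjoint_solution_def)
qed

text \<open>Replacing \<open>g\<close> by \<open>l + upper W l\<close> and moving
  \<open>upper\<close> over to \<open>h\<close> as \<open>lower\<close> leaves \<open>l\<close>
  paired with the right-hand side. This one identity yields the norm bound and both gradients
  without forming an inverse matrix.\<close>

lemma sum_adjoint_solution:
  assumes h: "\<And>p. p \<in> square m \<Longrightarrow> h p + lower m k W h p = r p"
  shows "(\<Sum>q\<in>square m. g q * h q) = (\<Sum>p\<in>square m. adjoint_solution m k W g p * r p)"
proof -
  let ?l = "adjoint_solution m k W g"
  have "(\<Sum>q\<in>square m. g q * h q) = (\<Sum>q\<in>square m. (?l q + upper m k W ?l q) * h q)"
    by (simp add: adjoint_solution)
  also have "\<dots> = (\<Sum>q\<in>square m. ?l q * h q) + (\<Sum>p\<in>square m. ?l p * lower m k W h p)"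
    by (simp add: lower_adjoint sum.distrib distrib_right)
  also have "\<dots> = (\<Sum>p\<in>square m. ?l p * (h p + lower m k W h p))"
    by (simp add: sum.distrib distrib_left)
  finally show ?thesis
    by (simp add: h)
qed

section \<open>Norm bounds and a chain rule\<close>

lemma abs_sum_mult_le_L2_set:
  assumes "finite A"
  shows "\<bar>\<Sum>i\<in>A. f i * h i\<bar> \<le> (\<Sum>i\<in>A. \<bar>f i\<bar>) * L2_set h A"
proof -
  have "\<bar>\<Sum>i\<in>A. f i * h i\<bar> \<le> (\<Sum>i\<in>A. \<bar>f i\<bar> * \<bar>h i\<bar>)"
    by (rule order_trans[OF sum_abs]) (simp add: abs_mult)
  also have "\<dots> \<le> (\<Sum>i\<in>A. \<bar>f i\<bar> * L2_set h A)"
  proof (intro sum_mono mult_left_mono)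
    fix i assume "i \<in> A"
    then show "\<bar>h i\<bar> \<le> L2_set h A"
      using member_le_L2_set[of A i "\<lambda>i. \<bar>h i\<bar>"] assms by (simp add: L2_set_def)
  qed simp
  finally show ?thesis
    by (simp add: sum_distrib_right)
qed

text \<open>Testing against the unit vector at \<open>q\<close> turns the adjoint solutions into a bound on the
  inverse of \<open>h \<mapsto> h + lower h\<close>.\<close>

lemma lower_solution_bound:
  "\<exists>K\<ge>0. \<forall>h r. (\<forall>p\<in>square m. h p + lower m k W h p = r p) \<longrightarrow>
      L2_set h (square m) \<le> K * L2_set r (square m)"
proof (intro exI conjI allI impI)
  let ?l = "\<lambda>q. adjoint_solution m k W (\<lambda>q'. of_bool (q' = q))"
  let ?K = "\<Sum>q\<in>square m. \<Sum>p\<in>square m. \<bar>?l q p\<bar>"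
  show "?K \<ge> 0"
    by (intro sum_nonneg) simp
  fix h r assume "\<forall>p\<in>square m. h p + lower m k W h p = r p"
  then have h: "\<And>p. p \<in> square m \<Longrightarrow> h p + lower m k W h p = r p"
    by blast
  have "\<bar>h q\<bar> \<le> (\<Sum>p\<in>square m. \<bar>?l q p\<bar>) * L2_set r (square m)" if "q \<in> square m" for q
  proof -
    have "h q = (\<Sum>q'\<in>square m. of_bool (q' = q) * h q')"
      using that by (simp add: of_bool_def if_distrib[of "\<lambda>a. a * _"] cong: if_cong)
    also have "\<dots> = (\<Sum>p\<in>square m. ?l q p * r p)"
      by (rule sum_adjoint_solution[OF h])
    finally show ?thesis
      using abs_sum_mult_le_L2_set[OF finite_square, of "?l q" r] by simp
  qed
  then show "L2_set h (square m) \<le> ?K * L2_set r (square m)"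
    unfolding sum_distrib_right by (intro order_trans[OF L2_set_le_sum_abs] sum_mono)
qed

text \<open>The constant is crude: one factor \<open>card (square m)\<close> comes from bounding the
  L2 norm by the sum over \<open>p\<close>, the other from the sum over \<open>q\<close>. What
  matters is the product of the two norms, which makes \<open>lower D h\<close> of second order when
  \<open>D\<close> and \<open>h\<close> are both small.\<close>

lemma L2_set_lower_le:
  "L2_set (lower m k D h) (square m) \<le>
     (real (card (square m))) ^ 2 * real (card (offsets k)) * (L2_set D (square k) * L2_set h (square m))"
proof -
  have le: "\<bar>f i\<bar> \<le> L2_set f A" if "finite A" "i \<in> A" for f :: "nat \<times> nat \<Rightarrow> real" and i A
    using member_le_L2_set[of A i "\<lambda>i. \<bar>f i\<bar>"] that by (simp add: L2_set_def)
  let ?b = "L2_set D (square k) * L2_set h (square m)"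
  have b: "\<bar>of_bool (linked k p q e) * (D e * h q)\<bar> \<le> ?b" if "q \<in> square m" "e \<in> offsets k" for p q e
  proof -
    have "\<bar>D e\<bar> * \<bar>h q\<bar> \<le> ?b"
      using that by (intro mult_mono le) (auto simp: offsets_def L2_set_nonneg)
    moreover have "?b \<ge> 0"
      by (simp add: L2_set_nonneg)
    ultimately show ?thesis
      by (cases "linked k p q e") (simp_all add: abs_mult)
  qed
  have "\<bar>lower m k D h p\<bar> \<le> real (card (square m)) * real (card (offsets k)) * ?b" for p
  proof -
    have "\<bar>lower m k D h p\<bar> \<le> (\<Sum>q\<in>square m. \<bar>\<Sum>e\<in>offsets k. of_bool (linked k p q e) * (D e * h q)\<bar>)"
      unfolding lower_def by (rule sum_abs)
    also have "\<dots> \<le> (\<Sum>q\<in>square m. \<Sum>e\<in>offsets k. \<bar>of_bool (linked k p q e) * (D e * h q)\<bar>)"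
      by (intro sum_mono sum_abs)
    also have "\<dots> \<le> (\<Sum>q\<in>square m. \<Sum>e\<in>offsets k. ?b)"
      by (intro sum_mono b)
    finally show ?thesis
      by (simp add: mult_ac)
  qed
  then have "L2_set (lower m k D h) (square m) \<le>
      (\<Sum>p\<in>square m. real (card (square m)) * real (card (offsets k)) * ?b)"
    by (intro order_trans[OF L2_set_le_sum_abs] sum_mono)
  then show ?thesis
    by (simp add: power2_eq_square mult_ac)
qed

text \<open>A chain rule that does not ask for the derivative of \<open>F\<close>. A local Lipschitz
  bound controls the remainder of \<open>L\<close>, and the linearisation is required only after
  pairing with \<open>g\<close>, which is what the adjoint identity provides.\<close>

lemma has_gradient_chain:
  assumes L: "has_gradient I L g (F x)"
    and F: "\<And>z. z \<in> J \<rightarrow>\<^sub>E UNIV \<Longrightarrow> F z \<in> I \<rightarrow>\<^sub>E UNIV"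
    and lip: "\<rho> > 0" "K \<ge> 0"
      "\<And>z. z \<in> J \<rightarrow>\<^sub>E UNIV \<Longrightarrow> L2_set (\<lambda>j. z j - x j) J < \<rho> \<Longrightarrow>
        L2_set (\<lambda>i. F z i - F x i) I \<le> K * L2_set (\<lambda>j. z j - x j) J"
    and lin: "\<And>\<epsilon>. \<epsilon> > 0 \<Longrightarrow> \<exists>\<delta>>0. \<forall>z \<in> J \<rightarrow>\<^sub>E UNIV. L2_set (\<lambda>j. z j - x j) J < \<delta> \<longrightarrow>
        \<bar>(\<Sum>i\<in>I. g i * (F z i - F x i)) - (\<Sum>j\<in>J. G j * (z j - x j))\<bar> \<le> \<epsilon> * L2_set (\<lambda>j. z j - x j) J"
  shows "has_gradient J (\<lambda>z. L (F z)) G x"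
  unfolding has_gradient_def
proof (intro allI impI)
  fix \<epsilon> :: real assume "\<epsilon> > 0"
  \<comment> \<open>Half of \<epsilon> is spent on the remainder of \<open>L\<close>, half on the
    linearisation; \<open>K + 1\<close> avoids a division by 0 when \<open>K = 0\<close>.\<close>
  have "\<epsilon> / (2 * (K + 1)) > 0"
    using \<open>\<epsilon> > 0\<close> lip(2) by simp
  then obtain \<delta>1 where \<delta>1: "\<delta>1 > 0"
    "\<And>w. w \<in> I \<rightarrow>\<^sub>E UNIV \<Longrightarrow> L2_set (\<lambda>i. w i - F x i) I < \<delta>1 \<Longrightarrow>
      \<bar>L w - L (F x) - (\<Sum>i\<in>I. g i * (w i - F x i))\<bar> \<le> \<epsilon> / (2 * (K + 1)) * L2_set (\<lambda>i. w i - F x i) I"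
    using L unfolding has_gradient_def by blast
  obtain \<delta>2 where \<delta>2: "\<delta>2 > 0"
    "\<And>z. z \<in> J \<rightarrow>\<^sub>E UNIV \<Longrightarrow> L2_set (\<lambda>j. z j - x j) J < \<delta>2 \<Longrightarrow>
      \<bar>(\<Sum>i\<in>I. g i * (F z i - F x i)) - (\<Sum>j\<in>J. G j * (z j - x j))\<bar> \<le> \<epsilon> / 2 * L2_set (\<lambda>j. z j - x j) J"
    using lin[of "\<epsilon> / 2"] \<open>\<epsilon> > 0\<close> by auto
  let ?\<delta> = "min \<rho> (min \<delta>2 (\<delta>1 / (K + 1)))"
  show "\<exists>\<delta>>0. \<forall>z\<in>J \<rightarrow>\<^sub>E UNIV. L2_set (\<lambda>j. z j - x j) J < \<delta> \<longrightarrow>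
      \<bar>L (F z) - L (F x) - (\<Sum>j\<in>J. G j * (z j - x j))\<bar> \<le> \<epsilon> * L2_set (\<lambda>j. z j - x j) J"
  proof (intro exI[of _ ?\<delta>] conjI ballI impI)
    show "?\<delta> > 0"
      using lip(1,2) \<delta>1(1) \<delta>2(1) by simp
    fix z assume z: "z \<in> J \<rightarrow>\<^sub>E UNIV" and small: "L2_set (\<lambda>j. z j - x j) J < ?\<delta>"
    let ?D = "L2_set (\<lambda>j. z j - x j) J" and ?H = "L2_set (\<lambda>i. F z i - F x i) I"
    have "?D \<ge> 0"
      by (rule L2_set_nonneg)
    have H: "?H \<le> (K + 1) * ?D"
      using lip(3)[OF z] small \<open>?D \<ge> 0\<close> by (auto simp: distrib_right intro: order_trans)
    also have "\<dots> < \<delta>1"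
      using small lip(2) by (simp add: pos_less_divide_eq mult.commute)
    finally have "\<bar>L (F z) - L (F x) - (\<Sum>i\<in>I. g i * (F z i - F x i))\<bar> \<le> \<epsilon> / (2 * (K + 1)) * ?H"
      by (intro \<delta>1(2) F z)
    also have "\<dots> \<le> \<epsilon> / (2 * (K + 1)) * ((K + 1) * ?D)"
      using H \<open>\<epsilon> > 0\<close> lip(2) by (intro mult_left_mono) auto
    also have "\<dots> = \<epsilon> / 2 * ?D"
      using lip(2) by (simp add: field_simps)
    finally have first: "\<bar>L (F z) - L (F x) - (\<Sum>i\<in>I. g i * (F z i - F x i))\<bar> \<le> \<epsilon> / 2 * ?D" .
    show "\<bar>L (F z) - L (F x) - (\<Sum>j\<in>J. G j * (z j - x j))\<bar> \<le> \<epsilon> * ?D"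
    proof -
      have "\<bar>(\<Sum>i\<in>I. g i * (F z i - F x i)) - (\<Sum>j\<in>J. G j * (z j - x j))\<bar> \<le> \<epsilon> / 2 * ?D"
        using \<delta>2(2)[OF z] small by simp
      with first show ?thesis
        by linarith
    qed
  qed
qed

section \<open>The input gradient and the weight gradient\<close>

lemma has_gradient_input:
  assumes y: "y \<in> arrays m" and L: "has_gradient (square m) L g (inv_conv m k W y)"
  shows "has_gradient (square m) (\<lambda>y'. L (inv_conv m k W y')) (adjoint_solution m k W g) y"
proof -
  obtain K where K: "K \<ge> 0" "\<And>h r. (\<And>p. p \<in> square m \<Longrightarrow> h p + lower m k W h p = r p) \<Longrightarrow>
      L2_set h (square m) \<le> K * L2_set r (square m)"
    using lower_solution_bound[of m k W] by blast
  let ?F = "inv_conv m k W"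
  have diff: "(?F z p - ?F y p) + lower m k W (\<lambda>p. ?F z p - ?F y p) p = z p - y p"
    if "z \<in> arrays m" "p \<in> square m" for z p
    using inv_conv(2)[OF that(1), of p k W] inv_conv(2)[OF y, of p k W] that(2)
    by (simp add: lower_diff[symmetric])
  \<comment> \<open>For fixed \<open>W\<close> the solution is linear in \<open>y\<close>: the
    linearisation is exact and the Lipschitz bound global, so both radii can be any positive number,
    here 1.\<close>
  show ?thesis
  proof (rule has_gradient_chain[where F = ?F and K = K, OF L])
    show "(1::real) > 0"
      by simp
  next
    fix \<epsilon> :: real assume "\<epsilon> > 0"
    moreover have "(\<Sum>p\<in>square m. g p * (?F z p - ?F y p)) =
        (\<Sum>p\<in>square m. adjoint_solution m k W g p * (z p - y p))" if "z \<in> arrays m" for z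
      by (rule sum_adjoint_solution[OF diff[OF that]])
    ultimately show "\<exists>\<delta>>0. \<forall>z \<in> square m \<rightarrow>\<^sub>E UNIV. L2_set (\<lambda>j. z j - y j) (square m) < \<delta> \<longrightarrow>
        \<bar>(\<Sum>p\<in>square m. g p * (?F z p - ?F y p)) -
          (\<Sum>p\<in>square m. adjoint_solution m k W g p * (z p - y p))\<bar> \<le> \<epsilon> * L2_set (\<lambda>j. z j - y j) (square m)"
      by (intro exI[of _ 1]) (auto simp: arrays_def L2_set_nonneg)
  qed (use K diff inv_conv(1) in \<open>auto simp: arrays_def\<close>)
qed

definition weight_gradient ::
  "nat \<Rightarrow> nat \<Rightarrow> (nat \<times> nat \<Rightarrow> real) \<Rightarrow> (nat \<times> nat \<Rightarrow> real) \<Rightarrow> nat \<times> nat \<Rightarrow> real" where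
  "weight_gradient m k l x e = (if e = (k, k) then 0
     else - (\<Sum>q\<in>square m. \<Sum>p\<in>square m. of_bool (linked k p q e) * (l p * x q)))"

text \<open>\<open>lower\<close> is bilinear in kernel and image. This transposes it in the kernel
  argument, as \<open>lower_adjoint\<close> does in the image argument.\<close>

lemma sum_weight_gradient:
  "(\<Sum>e\<in>square k. weight_gradient m k l x e * D e) = - (\<Sum>p\<in>square m. l p * lower m k D x p)"
proof -
  have "(\<Sum>e\<in>square k. weight_gradient m k l x e * D e) =
      (\<Sum>e\<in>offsets k. weight_gradient m k l x e * D e)"
    by (intro sum.mono_neutral_right) (auto simp: offsets_def weight_gradient_def)
  also have "\<dots> = (\<Sum>e\<in>offsets k. - (\<Sum>p\<in>square m. \<Sum>q\<in>square m. of_bool (linked k p q e) * (l p * x q)) * D e)"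
    by (intro sum.cong refl, subst sum.swap) (auto simp: offsets_def weight_gradient_def)
  also have "\<dots> = - (\<Sum>e\<in>offsets k. \<Sum>p\<in>square m. \<Sum>q\<in>square m. l p * (of_bool (linked k p q e) * (D e * x q)))"
    by (simp add: sum_negf sum_distrib_left sum_distrib_right mult_ac del: sum_of_bool_mult_eq)
  also have "(\<Sum>e\<in>offsets k. \<Sum>p\<in>square m. \<Sum>q\<in>square m. l p * (of_bool (linked k p q e) * (D e * x q))) =
      (\<Sum>p\<in>square m. \<Sum>e\<in>offsets k. \<Sum>q\<in>square m. l p * (of_bool (linked k p q e) * (D e * x q)))"
    by (rule sum.swap)
  also have "\<dots> = (\<Sum>p\<in>square m. \<Sum>q\<in>square m. \<Sum>e\<in>offsets k. l p * (of_bool (linked k p q e) * (D e * x q)))"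
    by (intro sum.cong refl sum.swap)
  also have "\<dots> = (\<Sum>p\<in>square m. l p * lower m k D x p)"
    by (simp add: lower_def sum_distrib_left del: sum_of_bool_mult_eq)
  finally show ?thesis .
qed

text \<open>With \<open>h\<close> the change of the output and \<open>D\<close> the change of the kernel,
  \<open>h + lower W h = - lower D x - lower D h\<close>, and the last term is of second order.\<close>

lemma has_gradient_weights:
  assumes y: "y \<in> arrays m" and x: "x = inv_conv m k W y" and L: "has_gradient (square m) L g x"
  shows "has_gradient (square k) (\<lambda>W'. L (inv_conv m k W' y))
    (weight_gradient m k (adjoint_solution m k W g) x) W"
proof -
  obtain K where K: "K \<ge> 0" "\<And>h r. (\<And>p. p \<in> square m \<Longrightarrow> h p + lower m k W h p = r p) \<Longrightarrow>
      L2_set h (square m) \<le> K * L2_set r (square m)"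
    using lower_solution_bound[of m k W] by blast
  define c where "c = (real (card (square m))) ^ 2 * real (card (offsets k))"
  define X where "X = L2_set x (square m)"
  define l where "l = adjoint_solution m k W g"
  define \<Lambda> where "\<Lambda> = (\<Sum>p\<in>square m. \<bar>l p\<bar>)"
  let ?F = "\<lambda>W'. inv_conv m k W' y"
  let ?D = "\<lambda>W'. L2_set (\<lambda>e. W' e - W e) (square k)"
  let ?h = "\<lambda>W' p. ?F W' p - x p"
  let ?H = "\<lambda>W'. L2_set (?h W') (square m)"
  let ?S = "2 * (K * c * X)"
  have nonneg: "c \<ge> 0" "X \<ge> 0" "\<Lambda> \<ge> 0" "K * c \<ge> 0" "?S \<ge> 0"
    using K(1) by (auto simp: c_def X_def \<Lambda>_def L2_set_nonneg sum_nonneg)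
  have D: "?D W' \<ge> 0" for W'
    by (rule L2_set_nonneg)
  have eq: "?h W' p + lower m k W (?h W') p = - lower m k (\<lambda>e. W' e - W e) (?F W') p"
    if "p \<in> square m" for W' p
    using inv_conv(2)[OF y that, of k W'] inv_conv(2)[OF y that, of k W]
    by (simp add: lower_diff[symmetric] lower_kernel_diff[symmetric] x)
  have split: "lower m k D (?F W') p = lower m k D x p + lower m k D (?h W') p" for D W' p
    by (simp add: lower_add)
  have uminus: "L2_set (\<lambda>p. - f p) A = L2_set f A" for f :: "nat \<times> nat \<Rightarrow> real" and A
    by (simp add: L2_set_def)
  \<comment> \<open>\<open>?H W'\<close> appears on both sides: it is at most
    \<open>K * c * ?D W' * (X + ?H W')\<close>. The radius forces
    \<open>K * c * ?D W' \<le> 1 / 2\<close>, so half of \<open>?H W'\<close> is absorbed and the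
    constant doubles. The \<open>+ 1\<close> covers \<open>K * c = 0\<close>.\<close>
  have lip: "?H W' \<le> ?S * ?D W'" if "?D W' < 1 / (2 * (K * c) + 1)" for W'
  proof -
    have small: "2 * (K * c * ?D W') \<le> 1"
    proof -
      have "?D W' * (2 * (K * c) + 1) < 1"
        using that nonneg(4) by (simp add: pos_less_divide_eq)
      then have "?D W' * (2 * (K * c)) + ?D W' \<le> 1"
        by (simp add: distrib_left)
      then have "?D W' * (2 * (K * c)) \<le> 1"
        using D[of W'] by linarith
      then show ?thesis
        by (simp add: mult_ac)
    qed
    have "?H W' \<le> K * L2_set (lower m k (\<lambda>e. W' e - W e) (?F W')) (square m)"
      using K(2)[OF eq[of _ W']] by (simp only: uminus)
    also have "\<dots> \<le> K * (c * (?D W' * L2_set (?F W') (square m)))"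
      unfolding c_def by (intro mult_left_mono L2_set_lower_le K(1))
    also have "\<dots> \<le> K * (c * (?D W' * (X + ?H W')))"
      using L2_set_triangle_ineq[of x "?h W'" "square m"] K(1) nonneg D
      by (intro mult_left_mono) (auto simp: X_def)
    also have "\<dots> = K * c * X * ?D W' + (K * c * ?D W') * ?H W'"
      by (simp add: algebra_simps)
    also have "(K * c * ?D W') * ?H W' \<le> 1 / 2 * ?H W'"
      using small by (intro mult_right_mono) (auto simp: L2_set_nonneg)
    finally show ?thesis
      by simp
  qed
  \<comment> \<open>Duality replaces \<open>h\<close> by the right-hand side
    \<open>- lower D (x + h)\<close>; its \<open>x\<close> part is the claimed linear term, its
    \<open>h\<close> part the remainder.\<close>
  have lin: "\<bar>(\<Sum>p\<in>square m. g p * ?h W' p) - (\<Sum>e\<in>square k. weight_gradient m k l x e * (W' e - W e))\<bar>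
      \<le> \<Lambda> * (c * (?D W' * ?H W'))" for W'
  proof -
    have "(\<Sum>p\<in>square m. g p * ?h W' p) =
        (\<Sum>p\<in>square m. l p * - lower m k (\<lambda>e. W' e - W e) (?F W') p)"
      unfolding l_def by (rule sum_adjoint_solution[OF eq])
    also have "\<dots> = - (\<Sum>p\<in>square m. l p * lower m k (\<lambda>e. W' e - W e) x p)
        - (\<Sum>p\<in>square m. l p * lower m k (\<lambda>e. W' e - W e) (?h W') p)"
      unfolding split by (simp add: sum.distrib sum_subtractf sum_negf distrib_left right_diff_distrib)
    finally have "\<bar>(\<Sum>p\<in>square m. g p * ?h W' p) - (\<Sum>e\<in>square k. weight_gradient m k l x e * (W' e - W e))\<bar>
        = \<bar>\<Sum>p\<in>square m. l p * lower m k (\<lambda>e. W' e - W e) (?h W') p\<bar>"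
      by (simp add: sum_weight_gradient)
    also have "\<dots> \<le> \<Lambda> * L2_set (lower m k (\<lambda>e. W' e - W e) (?h W')) (square m)"
      unfolding \<Lambda>_def by (rule abs_sum_mult_le_L2_set) simp
    also have "\<dots> \<le> \<Lambda> * (c * (?D W' * ?H W'))"
      unfolding c_def by (intro mult_left_mono L2_set_lower_le nonneg)
    finally show ?thesis .
  qed
  have "has_gradient (square k) (\<lambda>W'. L (?F W')) (weight_gradient m k l x) W"
  proof (rule has_gradient_chain[where I = "square m" and F = ?F and g = g
        and \<rho> = "1 / (2 * (K * c) + 1)" and K = ?S])
    show "has_gradient (square m) L g (?F W)"
      using L x by simp
    show "?F W' \<in> square m \<rightarrow>\<^sub>E UNIV" for W'
      using inv_conv(1)[OF y] by (simp add: arrays_def)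
    show "1 / (2 * (K * c) + 1) > 0" "?S \<ge> 0"
      using nonneg by auto
    show "L2_set (\<lambda>i. ?F W' i - ?F W i) (square m) \<le> ?S * ?D W'" if "?D W' < 1 / (2 * (K * c) + 1)" for W'
      using lip[OF that] by (simp add: x)
    fix \<epsilon> :: real assume "\<epsilon> > 0"
    let ?B = "\<Lambda> * (c * ?S)"
    have B: "?B \<ge> 0"
      using nonneg by simp
    \<comment> \<open>The remainder is at most \<open>?B * ?D W' * ?D W'\<close>, one factor from
      the kernel change and one from the Lipschitz bound. The second radius makes
      \<open>?B * ?D W'\<close> at most \<epsilon>.\<close>
    let ?\<delta> = "min (1 / (2 * (K * c) + 1)) (\<epsilon> / (?B + 1))"
    show "\<exists>\<delta>>0. \<forall>W' \<in> square k \<rightarrow>\<^sub>E UNIV. ?D W' < \<delta> \<longrightarrow>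
        \<bar>(\<Sum>p\<in>square m. g p * (?F W' p - ?F W p)) -
          (\<Sum>e\<in>square k. weight_gradient m k l x e * (W' e - W e))\<bar> \<le> \<epsilon> * ?D W'"
    proof (intro exI[of _ ?\<delta>] conjI ballI impI)
      show "?\<delta> > 0"
      proof -
        have "\<epsilon> / (?B + 1) > 0"
          using B \<open>\<epsilon> > 0\<close> by (intro divide_pos_pos add_nonneg_pos) auto
        moreover have "1 / (2 * (K * c) + 1) > 0"
          using nonneg(4) by simp
        ultimately show ?thesis
          by (simp only: min_less_iff_conj)
      qed
      fix W' assume small: "?D W' < ?\<delta>"
      have "\<Lambda> * (c * (?D W' * ?H W')) \<le> \<Lambda> * (c * (?D W' * (?S * ?D W')))"
        using lip[of W'] small nonneg D by (intro mult_left_mono) auto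
      also have "\<dots> = ?B * ?D W' * ?D W'"
        by (simp add: mult_ac)
      also have "\<dots> \<le> \<epsilon> * ?D W'"
      proof (intro mult_right_mono D)
        have "?D W' * (?B + 1) < \<epsilon>"
          using small B by (simp add: pos_less_divide_eq)
        then have "?D W' * ?B + ?D W' \<le> \<epsilon>"
          by (simp only: distrib_left mult_1_right)
        then have "?D W' * ?B \<le> \<epsilon>"
          using D[of W'] by linarith
        then show "?B * ?D W' \<le> \<epsilon>"
          by (simp only: mult.commute)
      qed
      finally show "\<bar>(\<Sum>p\<in>square m. g p * (?F W' p - ?F W p)) -
          (\<Sum>e\<in>square k. weight_gradient m k l x e * (W' e - W e))\<bar> \<le> \<epsilon> * ?D W'"
        using lin[of W'] by (simp add: x)
    qed
  qed
  then show ?thesis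
    by (simp add: l_def)
qed

section \<open>The program and its correctness\<close>

lemma sum_square: "(\<Sum>q\<in>square n. f q) = (\<Sum>r<n. \<Sum>c<n. f (Suc r, Suc c))"
proof -
  have "(\<Sum>c\<in>{1..n}. h c) = (\<Sum>c<n. h (Suc c))" for h :: "nat \<Rightarrow> 'a"
    by (rule sum.reindex_bij_witness[of _ Suc "\<lambda>c. c - 1"]) auto
  then show ?thesis
    by (simp only: square_def sum.cartesian_product')
qed

text \<open>The kernel counters run from \<open>k\<close> down to 1, so the kernel sums arrive in
  reverse order.\<close>

lemma sum_square_rev: "(\<Sum>j<n. \<Sum>l<n. f (n - j, n - l)) = (\<Sum>e\<in>square n. f e)"
proof -
  have rev: "(\<Sum>j<n. h (n - j)) = (\<Sum>j<n. h (Suc j))" for h :: "nat \<Rightarrow> 'a"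
    by (rule sum.reindex_bij_witness[of _ "\<lambda>j. n - Suc j" "\<lambda>j. n - Suc j"])
      (auto simp: Suc_diff_Suc)
  show ?thesis
    unfolding sum_square by (simp only: rev[of "\<lambda>v. f (_, v)"] rev[of "\<lambda>u. \<Sum>l<n. f (u, Suc l)"])
qed

text \<open>The value of \<open>l\<close> at the only pixel linked to \<open>q\<close> by
  \<open>e\<close>, namely \<open>q + (k, k) - e\<close>, or 0 outside the image. Upper bounds
  suffice as a test because kernel indices do not exceed \<open>k\<close>.\<close>

definition shifted ::
  "nat \<Rightarrow> nat \<Rightarrow> (nat \<times> nat \<Rightarrow> real) \<Rightarrow> nat \<times> nat \<Rightarrow> nat \<times> nat \<Rightarrow> real" where
  "shifted m k l q e =
     (if fst q + k - fst e \<le> m \<and> snd q + k - snd e \<le> m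
      then l (fst q + k - fst e, snd q + k - snd e) else 0)"

lemma sum_linked:
  assumes "q \<in> square m" "e \<in> square k"
  shows "(\<Sum>p\<in>square m. of_bool (linked k p q e) * (a * l p)) = a * shifted m k l q e"
proof -
  let ?p = "(fst q + k - fst e, snd q + k - snd e)"
  have linked: "linked k p q e \<longleftrightarrow> p = ?p" for p
    using assms by (auto simp: linked_def square_def prod_eq_iff)
  have "(\<Sum>p\<in>square m. of_bool (linked k p q e) * (a * l p)) =
      (\<Sum>p\<in>square m. if p = ?p then a * l p else 0)"
    by (intro sum.cong refl) (simp add: linked)
  also have "\<dots> = a * shifted m k l q e"
    using assms by (auto simp: shifted_def square_def)
  finally show ?thesis .
qed

lemma upper_shifted:
  assumes q: "q \<in> square m" and k: "k \<ge> 1" and W: "W (k, k) = 1"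
  shows "(\<Sum>e\<in>square k. W e * shifted m k l q e) = l q + upper m k W l q"
proof -
  have kk: "(k, k) \<in> square k"
    using k by (simp add: square_def)
  have "upper m k W l q = (\<Sum>e\<in>offsets k. W e * shifted m k l q e)"
    unfolding upper_def
    by (subst sum.swap) (intro sum.cong refl sum_linked[OF q], simp add: offsets_def)
  moreover have "(\<Sum>e\<in>square k. W e * shifted m k l q e) =
      W (k, k) * shifted m k l q (k, k) + (\<Sum>e\<in>offsets k. W e * shifted m k l q e)"
    unfolding offsets_def by (rule sum.remove[OF finite_square kk])
  moreover have "shifted m k l q (k, k) = l q"
    using q by (auto simp: shifted_def square_def)
  ultimately show ?thesis
    using W by simp
qed

text \<open>The sum runs over the whole kernel. The fixed entry \<open>W (k, k) = 1\<close>
  contributes the old iterate at \<open>q\<close>, which the leading summand cancels, so the loops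
  need no exception for it.\<close>

lemma jacobi_Suc_shifted:
  assumes "q \<in> square m" "k \<ge> 1" "W (k, k) = 1"
  shows "jacobi m k W g (Suc t) q = jacobi m k W g t q + g q -
    (\<Sum>j<k. \<Sum>l<k. W (k - j, k - l) * shifted m k (jacobi m k W g t) q (k - j, k - l))"
  using upper_shifted[of q m k W, OF assms]
  by (simp add: sum_square_rev[of "\<lambda>e. W e * shifted m k (jacobi m k W g t) q e"])

lemma weight_gradient_shifted:
  assumes "e \<in> square k" "e \<noteq> (k, k)"
  shows "weight_gradient m k l x e =
    - (\<Sum>r<m. \<Sum>c<m. shifted m k l (Suc r, Suc c) e * x (Suc r, Suc c))"
proof -
  have "(\<Sum>p\<in>square m. of_bool (linked k p q e) * (l p * x q)) = shifted m k l q e * x q"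
    if "q \<in> square m" for q
    using sum_linked[OF that assms(1), of "x q" l] by (simp add: mult_ac)
  then have "weight_gradient m k l x e = - (\<Sum>q\<in>square m. shifted m k l q e * x q)"
    using assms(2) by (simp add: weight_gradient_def)
  then show ?thesis
    by (simp add: sum_square)
qed

section \<open>Row-major numbering of pixels and registers\<close>

definition pixel :: "nat \<Rightarrow> nat \<Rightarrow> nat \<times> nat" where
  "pixel m i = (Suc (i div m), Suc (i mod m))"

lemma pixel_square: "i < m * m \<Longrightarrow> pixel m i \<in> square m"
  by (cases "m = 0") (auto simp: pixel_def square_def less_mult_imp_div_less Suc_le_eq)

lemma pixel_flat: "c < m \<Longrightarrow> pixel m (r * m + c) = (Suc r, Suc c)"
  by (simp add: pixel_def)

lemma flat_less: "r < m \<Longrightarrow> c < m \<Longrightarrow> r * m + c < m * (m::nat)"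
proof -
  assume "r < m" "c < m"
  then have "r * m + c < Suc r * m" "Suc r * m \<le> m * m"
    by (simp, intro mult_right_mono, simp_all)
  then show ?thesis
    by (rule less_le_trans)
qed

text \<open>\<open>rLast\<close> holds \<open>m - 1\<close>, \<open>rRowK\<close> and \<open>rColK\<close> the zero-based row and column of the processor's
  pixel plus \<open>k\<close>, and \<open>rU\<close>, \<open>rV\<close> the one-based kernel row and column, which count down to \<open>0\<close>.\<close>

abbreviation (input) "rZero \<equiv> 0 :: nat"
abbreviation (input) "rOne \<equiv> 1 :: nat"
abbreviation (input) "rM \<equiv> 2 :: nat"
abbreviation (input) "rK \<equiv> 3 :: nat"
abbreviation (input) "rId \<equiv> 4 :: nat"
abbreviation (input) "rRow \<equiv> 5 :: nat"
abbreviation (input) "rCol \<equiv> 6 :: nat"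
abbreviation (input) "rRowK \<equiv> 7 :: nat"
abbreviation (input) "rColK \<equiv> 8 :: nat"
abbreviation (input) "rLast \<equiv> 9 :: nat"
abbreviation (input) "rLam \<equiv> 10 :: nat"
abbreviation (input) "rOwn \<equiv> 11 :: nat"
abbreviation (input) "rG \<equiv> 12 :: nat"
abbreviation (input) "rX \<equiv> 13 :: nat"
abbreviation (input) "rBig \<equiv> 14 :: nat"
abbreviation (input) "rOut \<equiv> 15 :: nat"
abbreviation (input) "rOutOwn \<equiv> 16 :: nat"
abbreviation (input) "rOutRow \<equiv> 17 :: nat"
abbreviation (input) "rRowBig \<equiv> 18 :: nat"
abbreviation (input) "rCnt \<equiv> 19 :: nat"
abbreviation (input) "rU \<equiv> 20 :: nat"
abbreviation (input) "rV \<equiv> 21 :: nat"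
abbreviation (input) "rAcc \<equiv> 22 :: nat"
abbreviation (input) "rA \<equiv> 23 :: nat"
abbreviation (input) "rB \<equiv> 24 :: nat"
abbreviation (input) "rC \<equiv> 25 :: nat"
abbreviation (input) "rCell \<equiv> 26 :: nat"

section \<open>The program\<close>

definition decode_code :: com where
  "decode_code =
     Block [Const rOne 1, Load rM rZero, Load rK rOne, ProcId rId, Op Add rCnt rM rZero] ;;
     Loop (Block [Op Mul rA rCnt rM, Op Leq rA rA rId, Op Add rRow rRow rA, Op Sub rCnt rCnt rOne]) rCnt"

definition setup_code :: com where
  "setup_code =
     Block [Op Mul rCol rRow rM, Op Sub rCol rId rCol, Op Add rRowK rRow rK, Op Add rColK rCol rK,
       Op Sub rLast rM rOne] ;;
     Block [Op Mul rA rK rK, Op Mul rB rM rM,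
       Op Add rX rOne rOne, Op Add rX rX rA, Op Add rG rX rB, Op Add rLam rG rB,
       Op Add rOut rLam rB, Op Add rBig rOut rA] ;;
     Block [Op Add rX rX rId, Op Add rG rG rId, Op Add rOwn rLam rId,
       Op Mul rOutOwn rId rBig, Op Add rOutOwn rOutOwn rOut,
       Op Mul rRowBig rM rBig, Op Mul rOutRow rRow rRowBig, Op Add rOutRow rOutRow rOut] ;;
     Block [Load rX rX, Load rG rG, Op Add rCnt rM rM]"

text \<open>The comparisons form a mask, so that pixels outside the image contribute \<open>0\<close> without a
  branch; the masked address is still a natural number.\<close>

definition gather_code :: com where
  "gather_code =
     Block [Op Sub rA rRowK rU, Op Sub rB rColK rV, Op Leq rC rA rLast, Op Leq rCell rB rLast,
       Op Mul rC rC rCell, Op Mul rA rA rM, Op Add rA rA rB, Op Add rA rA rLam] ;;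
     Block [Load rA rA, Op Mul rC rC rA,
       Op Sub rA rU rOne, Op Mul rA rA rK, Op Add rA rA rV, Op Sub rA rA rOne]"

definition jacobi_row_code :: com where
  "jacobi_row_code =
     Block [Op Add rV rK rZero] ;;
     Loop (
       gather_code ;;
       Block [Op Add rA rA rOne, Op Add rA rA rOne] ;;
       Block [Load rA rA, Op Mul rA rA rC, Op Sub rAcc rAcc rA, Op Sub rV rV rOne]) rV ;;
     Block [Op Sub rU rU rOne]"

text \<open>The iterate is updated in place. In lockstep, all processors have finished reading
  before the common store, so no second buffer is needed.\<close>

definition jacobi_code :: com where
  "jacobi_code =
     Loop (
       Block [Load rAcc rOwn, Op Add rAcc rAcc rG, Op Add rU rK rZero] ;;
       Loop jacobi_row_code rU ;;
       Block [Store rOwn rAcc] ;;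
       Block [Op Sub rCnt rCnt rOne]) rCnt"

definition sum_code :: "nat \<Rightarrow> com" where
  "sum_code s = Loop (Block [Load rC rA, Op Add rAcc rAcc rC, Op Add rA rA s, Op Sub rCnt rCnt rOne]) rCnt"

text \<open>All processors of a row form the same row sum, and then all processors form the same
  total. The redundancy costs no time, is legal with concurrent reads, and avoids branching on the
  processor index.\<close>

definition weight_code :: com where
  "weight_code =
     gather_code ;;
     Block [Op Mul rC rC rX, Op Add rCell rA rOutOwn, Op Add rB rA rOut, Op Add rA rA rOutRow,
       Op Sub rAcc rAcc rAcc, Op Add rCnt rM rZero] ;;
     Block [Store rCell rC] ;;
     sum_code rBig ;;
     Block [Store rCell rAcc] ;;
     Block [Op Add rA rB rZero, Op Sub rAcc rAcc rAcc, Op Add rCnt rM rZero] ;;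
     sum_code rRowBig ;;
     Block [Op Sub rAcc rZero rAcc] ;;
     Block [Store rCell rAcc] ;;
     Block [Op Sub rV rV rOne]"

text \<open>The fixed entry \<open>(k, k)\<close> goes through the general computation; the final
  store replaces that value by 0.\<close>

definition weights_code :: com where
  "weights_code =
     Block [Op Add rU rK rZero] ;;
     Loop (
       Block [Op Add rV rK rZero] ;;
       Loop weight_code rV ;;
       Block [Op Sub rU rU rOne]) rU ;;
     Block [Op Mul rA rK rK, Op Sub rA rA rOne, Op Add rA rA rOutOwn] ;;
     Block [Store rA rZero]"

definition gradients_code :: com where
  "gradients_code = decode_code ;; setup_code ;; jacobi_code ;; weights_code"

text \<open>\<open>F\<close> is the frame: any register facts that survive updates of the four
  scratch registers. With it the same rule covers the sums along rows and the sum of the row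
  sums.\<close>

lemma valid_sum:
  assumes m: "m \<ge> 1"
    and Q: "\<And>M i j. Q M \<Longrightarrow> i < n \<Longrightarrow> j < m \<Longrightarrow> M (a i + j * d) = h i j"
    and F: "\<And>i R. F i R \<Longrightarrow> R s = real d \<and> R rOne = 1"
      "\<And>i R r b. F i R \<Longrightarrow> r \<in> {rC, rAcc, rA, rCnt} \<Longrightarrow> F i (R(r := b))"
    and s: "s \<notin> {rC, rAcc, rA, rCnt}"
  shows "valid n Q (\<lambda>i R. F i R \<and> R rA = real (a i) \<and> R rAcc = 0 \<and> R rCnt = real m) (sum_code s) (m * 5)
    Q (\<lambda>i R. F i R \<and> R rAcc = (\<Sum>j<m. h i j))"
proof -
  let ?P = "\<lambda>j i R. F i R \<and> R rA = real (a i + j * d) \<and> R rAcc = (\<Sum>j'<j. h i j') \<and> R rCnt = real (m - j)"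
  have "valid n Q (?P 0) (sum_code s) (m * (4 + 1)) Q (?P m)"
    unfolding sum_code_def
  proof (rule valid_Loop[where Q = "\<lambda>_. Q" and P = ?P])
    fix j assume j: "j < m"
    show "valid n Q (?P j) (Block [Load rC rA, Op Add rAcc rAcc rC, Op Add rA rA s, Op Sub rCnt rCnt rOne]) 4
        Q (?P (Suc j))"
    proof (rule valid_Block)
      fix M i R assume "Q M" "i < n" and P: "?P j i R"
      then have "M (a i + j * d) = h i j"
        using Q j by blast
      moreover have "R s = real d" "R rOne = 1"
        using F(1) P by blast+
      moreover have "F i (R(rC := w, rAcc := x, rA := y, rCnt := z))" for w x y z
        using P by (intro F(2)) auto
      moreover have "real (a i + j * d) + real d = real (a i + Suc j * d)" "real (m - j) - 1 = real (m - Suc j)"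
        using j by (simp_all add: of_nat_diff)
      ultimately show "block_ok M i [Load rC rA, Op Add rAcc rAcc rC, Op Add rA rA s, Op Sub rCnt rCnt rOne] R \<and>
          ?P (Suc j) i (exec_block M i [Load rC rA, Op Add rAcc rAcc rC, Op Add rA rA s, Op Sub rCnt rCnt rOne] R)"
        using P s by (simp del: of_nat_add)
    qed simp
  qed (use m in auto)
  then show ?thesis
    by (rule valid_weaken) simp_all
qed

section \<open>Memory layout and correctness of the phases\<close>

locale problem =
  fixes m k :: nat and W x g :: "nat \<times> nat \<Rightarrow> real"
  assumes m: "m \<ge> 1" and k: "k \<ge> 1" and W: "W (k, k) = 1"
begin

text \<open>These are the addresses prescribed for the two results. The Jacobi iterate lives at the
  place of the input gradient, so the last iterate needs no copying. \<open>stride\<close> is the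
  first address behind both results; as the distance between private copies it keeps all but the
  first clear of them.\<close>

definition "lam_base = 2 + k * k + 2 * (m * m)"
definition "out_base = lam_base + m * m"
definition "stride = out_base + k * k"

definition kernel_in :: "memory \<Rightarrow> bool" where
  "kernel_in M \<longleftrightarrow> (\<forall>u\<in>{1..k}. \<forall>v\<in>{1..k}. M ((u - 1) * k + (v - 1) + 2) = W (u, v))"

definition lam_in :: "(nat \<times> nat \<Rightarrow> real) \<Rightarrow> memory \<Rightarrow> bool" where
  "lam_in l M \<longleftrightarrow> (\<forall>i<m * m. M (lam_base + i) = l (pixel m i))"

definition input_in :: "memory \<Rightarrow> bool" where
  "input_in M \<longleftrightarrow> M 0 = real m \<and> M 1 = real k \<and>
     (\<forall>i<m * m. M (2 + k * k + i) = x (pixel m i) \<and> M (2 + k * k + m * m + i) = g (pixel m i))"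

definition params :: "nat \<Rightarrow> (nat \<Rightarrow> real) \<Rightarrow> bool" where
  "params i R \<longleftrightarrow> R rZero = 0 \<and> R rOne = 1 \<and> R rM = real m \<and> R rK = real k \<and>
     R rRowK = real (i div m + k) \<and> R rColK = real (i mod m + k) \<and> R rLast = real m - 1 \<and>
     R rLam = real lam_base \<and> R rOwn = real (lam_base + i) \<and>
     R rG = g (pixel m i) \<and> R rX = x (pixel m i) \<and>
     R rBig = real stride \<and> R rOut = real out_base \<and> R rOutOwn = real (i * stride + out_base) \<and>
     R rOutRow = real (i div m * (m * stride) + out_base) \<and> R rRowBig = real (m * stride)"

lemma lam_in_flat:
  assumes "lam_in l M" "r < m" "c < m"
  shows "M (lam_base + (r * m + c)) = l (Suc r, Suc c)"
  using assms flat_less[OF assms(2,3)] pixel_flat[OF assms(3)] by (simp add: lam_in_def)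

lemma real_mod: "real (i mod m) = real i - real (i div m) * real m"
  by (metis add_diff_cancel_left' div_mult_mod_eq of_nat_add of_nat_mult)

text \<open>The machine has no integer division. The row of pixel \<open>i\<close> is the number of
  positive multiples of \<open>m\<close> up to \<open>i\<close>, and \<open>i < m * m\<close>
  ensures that the first \<open>m\<close> multiples include them all.\<close>

lemma count_multiples:
  assumes "i < m * m"
  shows "(\<Sum>j<m. if (m - j) * m \<le> i then 1 else 0) = real (i div m)"
proof -
  have "(\<Sum>j<m. if (m - j) * m \<le> i then 1 else 0) = (\<Sum>j\<in>{j\<in>{..<m}. (m - j) * m \<le> i}. 1::real)"
    by (rule sum.inter_filter[symmetric]) simp
  also have "{j\<in>{..<m}. (m - j) * m \<le> i} = {m - i div m..<m}"
    using m by (auto simp: less_eq_div_iff_mult_less_eq[symmetric])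
  finally show ?thesis
    using assms m by (simp add: less_mult_imp_div_less less_imp_le)
qed

lemma valid_decode:
  "valid (m * m) (\<lambda>M. Q M \<and> input_in M) (\<lambda>i R. R = (\<lambda>_. 0)) decode_code (5 + m * 5)
    (\<lambda>M. Q M \<and> input_in M)
    (\<lambda>i R. R rZero = 0 \<and> R rOne = 1 \<and> R rM = real m \<and> R rK = real k \<and> R rId = real i \<and>
      R rRow = real (i div m))"
proof -
  let ?Q = "\<lambda>M. Q M \<and> input_in M"
  let ?P = "\<lambda>j i R. R rZero = 0 \<and> R rOne = 1 \<and> R rM = real m \<and> R rK = real k \<and> R rId = real i \<and>
      R rRow = (\<Sum>j'<j. if (m - j') * m \<le> i then 1 else 0) \<and> R rCnt = real (m - j)"
  have 1: "valid (m * m) ?Q (\<lambda>i R. R = (\<lambda>_. 0))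
      (Block [Const rOne 1, Load rM rZero, Load rK rOne, ProcId rId, Op Add rCnt rM rZero]) 5
      ?Q (?P 0)"
    by (rule valid_Block) (auto simp: input_in_def address_def)
  have 2: "valid (m * m) ?Q (?P 0) (Loop (Block
        [Op Mul rA rCnt rM, Op Leq rA rA rId, Op Add rRow rRow rA, Op Sub rCnt rCnt rOne]) rCnt) (m * (4 + 1))
      ?Q (?P m)"
  proof (rule valid_Loop[where Q = "\<lambda>_. ?Q" and P = ?P])
    fix j assume "j < m"
    moreover have "real (m - j) * real m \<le> real i \<longleftrightarrow> (m - j) * m \<le> i" for i
      by (metis of_nat_le_iff of_nat_mult)
    ultimately show "valid (m * m) ?Q (?P j) (Block
        [Op Mul rA rCnt rM, Op Leq rA rA rId, Op Add rRow rRow rA, Op Sub rCnt rCnt rOne]) 4 ?Q (?P (Suc j))"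
      by (intro valid_Block) (auto simp: of_nat_diff)
  qed (use m in auto)
  show ?thesis
    unfolding decode_code_def
    by (rule valid_weaken[OF valid_Seq[OF 1 2]]) (simp_all add: count_multiples)
qed

lemma valid_setup:
  "valid (m * m) (\<lambda>M. Q M \<and> input_in M)
    (\<lambda>i R. R rZero = 0 \<and> R rOne = 1 \<and> R rM = real m \<and> R rK = real k \<and> R rId = real i \<and>
      R rRow = real (i div m))
    setup_code 24 (\<lambda>M. Q M \<and> input_in M) (\<lambda>i R. params i R \<and> R rCnt = real (2 * m))"
proof -
  let ?Q = "\<lambda>M. Q M \<and> input_in M"
  let ?P0 = "\<lambda>i R. R rZero = 0 \<and> R rOne = 1 \<and> R rM = real m \<and> R rK = real k \<and> R rId = real i \<and>
      R rRow = real (i div m)"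
  let ?P1 = "\<lambda>i R. ?P0 i R \<and> R rRowK = real (i div m + k) \<and> R rColK = real (i mod m + k) \<and> R rLast = real m - 1"
  let ?P2 = "\<lambda>i R. ?P1 i R \<and> R rX = real (2 + k * k) \<and> R rG = real (2 + k * k + m * m) \<and>
      R rLam = real lam_base \<and> R rOut = real out_base \<and> R rBig = real stride"
  let ?P3 = "\<lambda>i R. ?P1 i R \<and> R rX = real (2 + k * k + i) \<and> R rG = real (2 + k * k + m * m + i) \<and>
      R rLam = real lam_base \<and> R rOut = real out_base \<and> R rBig = real stride \<and>
      R rOwn = real (lam_base + i) \<and> R rOutOwn = real (i * stride + out_base) \<and>
      R rOutRow = real (i div m * (m * stride) + out_base) \<and> R rRowBig = real (m * stride)"
  have 1: "valid (m * m) ?Q ?P0 (Block [Op Mul rCol rRow rM, Op Sub rCol rId rCol, Op Add rRowK rRow rK,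
      Op Add rColK rCol rK, Op Sub rLast rM rOne]) 5 ?Q ?P1"
    by (rule valid_Block) (auto simp: real_mod)
  have 2: "valid (m * m) ?Q ?P1 (Block [Op Mul rA rK rK, Op Mul rB rM rM,
       Op Add rX rOne rOne, Op Add rX rX rA, Op Add rG rX rB, Op Add rLam rG rB,
       Op Add rOut rLam rB, Op Add rBig rOut rA]) 8 ?Q ?P2"
    by (rule valid_Block) (auto simp: lam_base_def out_base_def stride_def)
  have 3: "valid (m * m) ?Q ?P2 (Block [Op Add rX rX rId, Op Add rG rG rId, Op Add rOwn rLam rId,
       Op Mul rOutOwn rId rBig, Op Add rOutOwn rOutOwn rOut,
       Op Mul rRowBig rM rBig, Op Mul rOutRow rRow rRowBig, Op Add rOutRow rOutRow rOut]) 8 ?Q ?P3"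
    by (rule valid_Block) auto
  have 4: "valid (m * m) ?Q ?P3 (Block [Load rX rX, Load rG rG, Op Add rCnt rM rM]) 3
      ?Q (\<lambda>i R. params i R \<and> R rCnt = real (2 * m))"
    by (rule valid_Block)
      (auto simp: params_def input_in_def simp del: of_nat_add of_nat_mult of_nat_Suc)
  show ?thesis
    unfolding setup_code_def
    by (rule valid_weaken[OF valid_Seq[OF 1 valid_Seq[OF 2 valid_Seq[OF 3 4]]]]) simp_all
qed

text \<open>\<open>F\<close> carries the caller's invariant on the accumulator and the counter,
  which are left alone. The index left in \<open>rA\<close> is the row-major kernel position, used
  for reading \<open>W\<close> and for addressing the weight result.\<close>

lemma valid_gather:
  assumes u: "u \<in> {1..k}" and v: "v \<in> {1..k}" and Q: "\<And>M. Q M \<Longrightarrow> lam_in l M"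
  shows "valid (m * m) Q
    (\<lambda>i R. params i R \<and> R rU = real u \<and> R rV = real v \<and> F i (R rAcc) (R rCnt))
    gather_code 14 Q
    (\<lambda>i R. params i R \<and> R rU = real u \<and> R rV = real v \<and> F i (R rAcc) (R rCnt) \<and>
      R rC = shifted m k l (pixel m i) (u, v) \<and> R rA = real ((u - 1) * k + (v - 1)))"
proof -
  let ?P = "\<lambda>i R. params i R \<and> R rU = real u \<and> R rV = real v \<and> F i (R rAcc) (R rCnt)"
  obtain u' v' where uv: "u = Suc u'" "v = Suc v'" "u' < k" "v' < k"
    using u v by (cases u; cases v) auto
  let ?r = "\<lambda>i. i div m + k - u" and ?c = "\<lambda>i. i mod m + k - v"
  define a where "a i = lam_base + (?r i * m + ?c i)" for i
  let ?P1 = "\<lambda>i R. ?P i R \<and> R rC = of_bool (?r i < m \<and> ?c i < m) \<and> R rA = real (a i)"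
  let ?address = "[Op Sub rA rRowK rU, Op Sub rB rColK rV, Op Leq rC rA rLast, Op Leq rCell rB rLast,
      Op Mul rC rC rCell, Op Mul rA rA rM, Op Add rA rA rB, Op Add rA rA rLam]"
  let ?load = "[Load rA rA, Op Mul rC rC rA, Op Sub rA rU rOne, Op Mul rA rA rK, Op Add rA rA rV, Op Sub rA rA rOne]"
  have 1: "valid (m * m) Q ?P (Block ?address) 8 Q ?P1"
  proof (rule valid_Block)
    fix M i R assume "?P i R"
    moreover have "real (a i) = (real (i div m + k) - real u) * real m + (real (i mod m + k) - real v) + real lam_base"
      using u v by (simp add: a_def of_nat_diff)
    moreover have "real (i div m + k) - real u \<le> real m - 1 \<longleftrightarrow> ?r i < m"
      "real (i mod m + k) - real v \<le> real m - 1 \<longleftrightarrow> ?c i < m"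
      using u v by auto
    ultimately show "block_ok M i ?address R \<and> ?P1 i (exec_block M i ?address R)"
      by (simp add: params_def del: of_nat_add)
  qed simp
  have 2: "valid (m * m) Q ?P1 (Block ?load) 6 Q
      (\<lambda>i R. ?P i R \<and> R rC = shifted m k l (pixel m i) (u, v) \<and> R rA = real ((u - 1) * k + (v - 1)))"
  proof (rule valid_Block)
    fix M i R assume M: "Q M" and P: "?P1 i R"
    \<comment> \<open>Registers hold zero-based coordinates and \<open>pixel\<close> is one-based,
      so \<open>?r i < m\<close> matches the test \<open>\<le> m\<close> in \<open>shifted\<close>.
      When a test fails, whatever was loaded is multiplied by 0.\<close>
    have "of_bool (?r i < m \<and> ?c i < m) * M (a i) = shifted m k l (pixel m i) (u, v)"
      using lam_in_flat[OF Q[OF M], of "?r i" "?c i"] u v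
      by (auto simp: shifted_def pixel_def Suc_diff_le a_def)
    then show "block_ok M i ?load R \<and> ?P i (exec_block M i ?load R) \<and>
        exec_block M i ?load R rC = shifted m k l (pixel m i) (u, v) \<and>
        exec_block M i ?load R rA = real ((u - 1) * k + (v - 1))"
      using P unfolding uv(1,2) by (simp add: params_def)
  qed simp
  show ?thesis
    unfolding gather_code_def
    by (rule valid_weaken[OF valid_Seq[OF 1 2]]) simp_all
qed

lemma lam_in_cong:
  assumes "lam_in l M" "\<And>a. a < out_base \<Longrightarrow> M' a = M a"
  shows "lam_in l M'"
  using assms by (simp add: lam_in_def out_base_def)

lemma kernel_in_cong:
  assumes "kernel_in M" "\<And>a. a < lam_base \<Longrightarrow> M' a = M a"
  shows "kernel_in M'"
proof -
  have "(u - 1) * k + (v - 1) + 2 < lam_base" if "u \<in> {1..k}" "v \<in> {1..k}" for u v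
  proof -
    have "(u - 1) * k + (v - 1) < k * k"
      using that by (intro flat_less) auto
    then show ?thesis
      unfolding lam_base_def by linarith
  qed
  then show ?thesis
    using assms by (simp add: kernel_in_def)
qed

lemma valid_jacobi_row:
  assumes j: "j < k" and Q: "\<And>M. Q M \<Longrightarrow> lam_in l M \<and> kernel_in M"
  shows "valid (m * m) Q (\<lambda>i R. params i R \<and> R rU = real (k - j) \<and> R rCnt = c \<and> R rAcc = a i)
    jacobi_row_code (k * 21 + 2) Q
    (\<lambda>i R. params i R \<and> R rU = real (k - Suc j) \<and> R rCnt = c \<and>
      R rAcc = a i - (\<Sum>j'<k. W (k - j, k - j') * shifted m k l (pixel m i) (k - j, k - j')))"
proof -
  let ?T = "\<lambda>i j'. W (k - j, k - j') * shifted m k l (pixel m i) (k - j, k - j')"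
  let ?F = "\<lambda>j' i acc cnt. cnt = c \<and> acc = a i - (\<Sum>j''<j'. ?T i j'')"
  let ?P = "\<lambda>j' i R. params i R \<and> R rU = real (k - j) \<and> R rV = real (k - j') \<and> ?F j' i (R rAcc) (R rCnt)"
  have loop: "valid (m * m) Q (?P 0) (Loop (
       gather_code ;;
       Block [Op Add rA rA rOne, Op Add rA rA rOne] ;;
       Block [Load rA rA, Op Mul rA rA rC, Op Sub rAcc rAcc rA, Op Sub rV rV rOne]) rV) (k * (20 + 1)) Q (?P k)"
  proof (rule valid_Loop[where Q = "\<lambda>_. Q" and P = ?P])
    fix j' assume j': "j' < k"
    define f where "f = (k - j - 1) * k + (k - j' - 1)"
    \<comment> \<open>The kernel starts at address 2, behind \<open>m\<close> and
      \<open>k\<close>.\<close>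
    define w where "w = f + 2"
    let ?S = "\<lambda>i R. R rC = shifted m k l (pixel m i) (k - j, k - j')"
    have uv: "k - j \<in> {1..k}" "k - j' \<in> {1..k}"
      using j j' by auto
    have 1: "valid (m * m) Q (?P j') gather_code 14 Q (\<lambda>i R. ?P j' i R \<and> ?S i R \<and> R rA = real f)"
      by (rule valid_weaken[OF valid_gather[where Q = Q and F = "?F j'" and l = l, OF uv]]) (use Q in \<open>auto simp: f_def\<close>)
    have 2: "valid (m * m) Q (\<lambda>i R. ?P j' i R \<and> ?S i R \<and> R rA = real f)
        (Block [Op Add rA rA rOne, Op Add rA rA rOne]) 2 Q (\<lambda>i R. ?P j' i R \<and> ?S i R \<and> R rA = real w)"
      by (rule valid_Block) (auto simp: params_def w_def)
    have 3: "valid (m * m) Q (\<lambda>i R. ?P j' i R \<and> ?S i R \<and> R rA = real w)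
        (Block [Load rA rA, Op Mul rA rA rC, Op Sub rAcc rAcc rA, Op Sub rV rV rOne]) 4 Q (?P (Suc j'))"
    proof (rule valid_Block)
      fix M i R assume M: "Q M" and P: "?P j' i R \<and> ?S i R \<and> R rA = real w"
      have "M w = W (k - j, k - j')"
        using Q[OF M] uv unfolding kernel_in_def w_def f_def by blast
      moreover have "real (k - j') - 1 = real (k - Suc j')"
        using j' by (simp add: of_nat_diff)
      ultimately show "block_ok M i [Load rA rA, Op Mul rA rA rC, Op Sub rAcc rAcc rA, Op Sub rV rV rOne] R \<and>
          ?P (Suc j') i (exec_block M i [Load rA rA, Op Mul rA rA rC, Op Sub rAcc rAcc rA, Op Sub rV rV rOne] R)"
        using P by (simp add: params_def)
    qed simp
    show "valid (m * m) Q (?P j') (gather_code ;;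
       Block [Op Add rA rA rOne, Op Add rA rA rOne] ;;
       Block [Load rA rA, Op Mul rA rA rC, Op Sub rAcc rAcc rA, Op Sub rV rV rOne]) 20 Q (?P (Suc j'))"
      by (rule valid_weaken[OF valid_Seq[OF 1 valid_Seq[OF 2 3]]]) simp_all
  qed (use k in auto)
  have init: "valid (m * m) Q (\<lambda>i R. params i R \<and> R rU = real (k - j) \<and> R rCnt = c \<and> R rAcc = a i)
      (Block [Op Add rV rK rZero]) 1 Q (?P 0)"
    by (rule valid_Block) (auto simp: params_def)
  have final: "valid (m * m) Q (?P k) (Block [Op Sub rU rU rOne]) 1 Q
      (\<lambda>i R. params i R \<and> R rU = real (k - Suc j) \<and> ?F k i (R rAcc) (R rCnt))"
    using j by (intro valid_Block) (auto simp: params_def of_nat_diff)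
  show ?thesis
    unfolding jacobi_row_code_def
    by (rule valid_weaken[OF valid_Seq[OF init valid_Seq[OF loop final]]]) simp_all
qed

lemma valid_jacobi:
  "valid (m * m) (\<lambda>M. lam_in (jacobi m k W g 0) M \<and> kernel_in M) (\<lambda>i R. params i R \<and> R rCnt = real (2 * m))
    jacobi_code (2 * m * (k * (k * 21 + 3) + 6))
    (\<lambda>M. lam_in (adjoint_solution m k W g) M) (\<lambda>i R. params i R)"
proof -
  let ?Q = "\<lambda>t M. lam_in (jacobi m k W g t) M \<and> kernel_in M"
  let ?P = "\<lambda>t i R. params i R \<and> R rCnt = real (2 * m - t)"
  have "valid (m * m) (?Q 0) (?P 0) jacobi_code (2 * m * ((k * (k * 21 + 3) + 5) + 1)) (?Q (2 * m)) (?P (2 * m))"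
    unfolding jacobi_code_def
  proof (rule valid_Loop[where Q = ?Q and P = ?P])
    fix t assume t: "t < 2 * m"
    let ?l = "jacobi m k W g t"
    let ?T = "\<lambda>i j. \<Sum>j'<k. W (k - j, k - j') * shifted m k ?l (pixel m i) (k - j, k - j')"
    let ?P1 = "\<lambda>j i R. params i R \<and> R rU = real (k - j) \<and> R rCnt = real (2 * m - t) \<and>
      R rAcc = ?l (pixel m i) + g (pixel m i) - (\<Sum>j'<j. ?T i j')"
    have 1: "valid (m * m) (?Q t) (?P t) (Block [Load rAcc rOwn, Op Add rAcc rAcc rG, Op Add rU rK rZero]) 3
        (?Q t) (?P1 0)"
      by (rule valid_Block) (auto simp: params_def lam_in_def simp del: of_nat_add)
    have 2: "valid (m * m) (?Q t) (?P1 0) (Loop jacobi_row_code rU) (k * ((k * 21 + 2) + 1)) (?Q t) (?P1 k)"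
    proof (rule valid_Loop[where Q = "\<lambda>_. ?Q t" and P = ?P1])
      fix j assume "j < k"
      from valid_jacobi_row[OF this, where Q = "?Q t" and l = ?l and c = "real (2 * m - t)" and
          a = "\<lambda>i. ?l (pixel m i) + g (pixel m i) - (\<Sum>j'<j. ?T i j')"]
      show "valid (m * m) (?Q t) (?P1 j) jacobi_row_code (k * 21 + 2) (?Q t) (?P1 (Suc j))"
        by (rule valid_weaken) auto
    qed (use k in auto)
    have 3: "valid (m * m) (?Q t) (?P1 k) (Block [Store rOwn rAcc]) 1 (?Q (Suc t)) (?P1 k)"
    proof (rule valid_Store[where ad = "\<lambda>i. lam_base + i" and val = "\<lambda>i. jacobi m k W g (Suc t) (pixel m i)"])
      fix i R assume "i < m * m" "?P1 k i R"
      then show "R rOwn = real (lam_base + i) \<and> R rAcc = jacobi m k W g (Suc t) (pixel m i)"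
        using jacobi_Suc_shifted[OF pixel_square, where W = W and k = k and t = t, of i m g] k W
        by (simp add: params_def)
    next
      fix M M' assume M: "?Q t M" "\<forall>i<m * m. M' (lam_base + i) = jacobi m k W g (Suc t) (pixel m i)"
        "\<forall>a. a \<notin> (\<lambda>i. lam_base + i) ` {..<m * m} \<longrightarrow> M' a = M a"
      have "M' a = M a" if "a < lam_base" for a
      proof -
        have "a \<notin> (\<lambda>i. lam_base + i) ` {..<m * m}"
          using that by auto
        with M(3) show ?thesis
          by blast
      qed
      with M show "?Q (Suc t) M'"
        using kernel_in_cong[of M M'] by (auto simp: lam_in_def)
    qed (auto simp: inj_on_def)
    have 4: "valid (m * m) (?Q (Suc t)) (?P1 k) (Block [Op Sub rCnt rCnt rOne]) 1 (?Q (Suc t)) (?P (Suc t))"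
      using t by (intro valid_Block) (auto simp: params_def of_nat_diff)
    show "valid (m * m) (?Q t) (?P t) (
       Block [Load rAcc rOwn, Op Add rAcc rAcc rG, Op Add rU rK rZero] ;;
       Loop jacobi_row_code rU ;;
       Block [Store rOwn rAcc] ;;
       Block [Op Sub rCnt rCnt rOne]) (k * (k * 21 + 3) + 5) (?Q (Suc t)) (?P (Suc t))"
      by (rule valid_weaken[OF valid_Seq[OF 1 valid_Seq[OF 2 valid_Seq[OF 3 4]]]]) (simp_all add: distrib_left)
  qed (use m in auto)
  then show ?thesis
    by (rule valid_weaken) (simp_all add: adjoint_solution_def)
qed

section \<open>Correctness of the weight phase\<close>

definition weight_sum :: "(nat \<times> nat \<Rightarrow> real) \<Rightarrow> nat \<times> nat \<Rightarrow> real" where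
  "weight_sum l e = - (\<Sum>r<m. \<Sum>c<m. shifted m k l (Suc r, Suc c) e * x (Suc r, Suc c))"

text \<open>The last \<open>n\<close> kernel entries in row-major order are finished.\<close>

definition sums_in :: "(nat \<times> nat \<Rightarrow> real) \<Rightarrow> nat \<Rightarrow> memory \<Rightarrow> bool" where
  "sums_in l n M \<longleftrightarrow> lam_in l M \<and>
     (\<forall>f<k * k. k * k \<le> f + n \<longrightarrow> M (out_base + f) = weight_sum l (pixel k f))"

text \<open>Processor \<open>0\<close> writes to the result, every other processor to a copy of the result array in
  unused memory, so that all writes are exclusive.\<close>

definition cell :: "nat \<Rightarrow> nat \<Rightarrow> nat" where
  "cell f i = i * stride + (out_base + f)"

lemma inj_cell: "inj_on (cell f) {..<n}"
proof -
  have "stride > 0"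
    by (simp add: stride_def out_base_def lam_base_def)
  then show ?thesis
    by (auto simp: cell_def inj_on_def)
qed

lemma cell_notin: "a < out_base + k * k \<Longrightarrow> a \<noteq> out_base + f \<Longrightarrow> a \<notin> cell f ` {..<n}"
proof
  assume a: "a < out_base + k * k" "a \<noteq> out_base + f" "a \<in> cell f ` {..<n}"
  then obtain i where i: "a = cell f i"
    by auto
  with a(1,2) show False
    by (cases i) (auto simp: cell_def stride_def)
qed

lemma sums_in_cong:
  assumes "sums_in l n M" "f + Suc n \<le> k * k" "\<forall>a. a \<notin> cell f ` {..<n'} \<longrightarrow> M' a = M a"
  shows "sums_in l n M'"
proof -
  have "M' a = M a" if "a < out_base" for a
    using that assms(3) cell_notin[of a f n'] by auto
  then have "lam_in l M'"
    using lam_in_cong assms(1) unfolding sums_in_def by blast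
  moreover have "M' (out_base + f') = M (out_base + f')" if "f' < k * k" "k * k \<le> f' + n" for f'
    using that assms(2,3) cell_notin[of "out_base + f'" f n'] by auto
  ultimately show ?thesis
    using assms(1) by (simp add: sums_in_def)
qed

lemma valid_weight:
  assumes u: "u \<in> {1..k}" and v: "v \<in> {1..k}" and n: "(u - 1) * k + (v - 1) + Suc n = k * k"
  shows "valid (m * m) (sums_in l n) (\<lambda>i R. params i R \<and> R rU = real u \<and> R rV = real v)
    weight_code (28 + 10 * m) (sums_in l (Suc n)) (\<lambda>i R. params i R \<and> R rU = real u \<and> R rV = real (v - 1))"
proof -
  let ?N = "m * m"
  define f where "f = (u - 1) * k + (v - 1)"
  define p where "p i = shifted m k l (pixel m i) (u, v) * x (pixel m i)" for i
  \<comment> \<open>\<open>s i\<close> depends only on the row of \<open>i\<close>; the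
    representatives \<open>s (r * m)\<close> are the row sums.\<close>
  define s where "s i = (\<Sum>c<m. p (i div m * m + c))" for i
  have fn: "f + Suc n \<le> k * k"
    using n by (simp add: f_def)
  have sum: "(\<Sum>r<m. s (r * m)) = (\<Sum>r<m. \<Sum>c<m. shifted m k l (Suc r, Suc c) (u, v) * x (Suc r, Suc c))"
    using m by (auto simp: s_def p_def pixel_flat intro!: sum.cong)
  let ?P = "\<lambda>i R. params i R \<and> R rU = real u \<and> R rV = real v"
  let ?F = "\<lambda>i R. ?P i R \<and> R rCell = real (cell f i) \<and> R rB = real (out_base + f)"
  let ?A = "\<lambda>i R. R rA = real (i div m * (m * stride) + out_base + f) \<and> R rAcc = 0 \<and> R rCnt = real m"
  let ?Q = "\<lambda>h M. sums_in l n M \<and> (\<forall>i<?N. M (cell f i) = h i)"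
  have 1: "valid ?N (sums_in l n) ?P gather_code 14 (sums_in l n)
      (\<lambda>i R. ?P i R \<and> R rC = shifted m k l (pixel m i) (u, v) \<and> R rA = real f)"
    by (rule valid_weaken[OF valid_gather[where F = "\<lambda>_ _ _. True" and l = l and Q = "sums_in l n", OF u v]])
      (auto simp: sums_in_def f_def)
  have 2: "valid ?N (sums_in l n)
      (\<lambda>i R. ?P i R \<and> R rC = shifted m k l (pixel m i) (u, v) \<and> R rA = real f)
      (Block [Op Mul rC rC rX, Op Add rCell rA rOutOwn, Op Add rB rA rOut, Op Add rA rA rOutRow,
       Op Sub rAcc rAcc rAcc, Op Add rCnt rM rZero]) 6 (sums_in l n)
      (\<lambda>i R. ?F i R \<and> ?A i R \<and> R rC = p i)"
    by (rule valid_Block) (auto simp: params_def cell_def p_def)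
  \<comment> \<open>Covers all three stores: they touch only the cells of entry \<open>f\<close>,
    which is not yet among the finished ones.\<close>
  have store: "valid ?N (sums_in l n) P (Block [Store rCell r]) 1 (?Q h) P"
    if "\<And>i R. i < ?N \<Longrightarrow> P i R \<Longrightarrow> R rCell = real (cell f i) \<and> R r = h i" for P r h
    using that
    by (rule valid_Store[where ad = "cell f" and val = h])
      (auto simp: inj_cell intro: sums_in_cong[OF _ fn])
  have 3: "valid ?N (sums_in l n) (\<lambda>i R. ?F i R \<and> ?A i R \<and> R rC = p i)
      (Block [Store rCell rC]) 1 (?Q p) (\<lambda>i R. ?F i R \<and> ?A i R)"
    by (rule valid_weaken[OF store[of "\<lambda>i R. ?F i R \<and> ?A i R \<and> R rC = p i" rC p]]) auto
  have F: "R rBig = real stride \<and> R rOne = 1" "R rRowBig = real (m * stride) \<and> R rOne = 1"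
    if "?F i R" for i R
    using that by (simp_all add: params_def)
  have F_upd: "?F i (R(r := b))" if "?F i R" "r \<in> {rC, rAcc, rA, rCnt}" for i R r b
  proof -
    have upd: "(R'(r := b)) q = R' q" if "q \<notin> {rC, rAcc, rA, rCnt}" for R' :: "nat \<Rightarrow> real" and q
      using that \<open>r \<in> {rC, rAcc, rA, rCnt}\<close> by auto
    then show ?thesis
      using \<open>?F i R\<close> by (simp add: params_def upd del: fun_upd_apply)
  qed
  have 4: "valid ?N (?Q p) (\<lambda>i R. ?F i R \<and> ?A i R) (sum_code rBig) (m * 5)
      (?Q p) (\<lambda>i R. ?F i R \<and> R rAcc = s i)"
    unfolding s_def
  proof (rule valid_sum[where F = ?F and d = stride and a = "\<lambda>i. i div m * (m * stride) + out_base + f" and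
        h = "\<lambda>i c. p (i div m * m + c)", OF m])
    show "?F i R \<Longrightarrow> R rBig = real stride \<and> R rOne = 1" for i R
      by (rule F(1))
    show "?F i R \<Longrightarrow> r \<in> {rC, rAcc, rA, rCnt} \<Longrightarrow> ?F i (R(r := b))" for i R r b
      by (rule F_upd)
    fix M i j assume M: "?Q p M" and i: "i < ?N" and j: "j < m"
    have "i div m * m + j < ?N"
      using i j by (intro flat_less) (auto simp: less_mult_imp_div_less)
    with M have "M (cell f (i div m * m + j)) = p (i div m * m + j)"
      by blast
    moreover have "cell f (i div m * m + j) = i div m * (m * stride) + out_base + f + j * stride"
      by (simp add: cell_def algebra_simps)
    ultimately show "M (i div m * (m * stride) + out_base + f + j * stride) = p (i div m * m + j)"
      by simp
  qed simp
  have 5: "valid ?N (?Q p) (\<lambda>i R. ?F i R \<and> R rAcc = s i) (Block [Store rCell rAcc]) 1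
      (?Q s) (\<lambda>i R. ?F i R \<and> R rAcc = s i)"
    by (rule valid_weaken[OF store[of "\<lambda>i R. ?F i R \<and> R rAcc = s i" rAcc s]]) auto
  have 6: "valid ?N (?Q s) (\<lambda>i R. ?F i R \<and> R rAcc = s i)
      (Block [Op Add rA rB rZero, Op Sub rAcc rAcc rAcc, Op Add rCnt rM rZero]) 3
      (?Q s) (\<lambda>i R. ?F i R \<and> R rA = real (out_base + f) \<and> R rAcc = 0 \<and> R rCnt = real m)"
    by (rule valid_Block) (auto simp: params_def)
  \<comment> \<open>Every processor reads the same cells, those of the first processor of each
    row.\<close>
  have 7: "valid ?N (?Q s) (\<lambda>i R. ?F i R \<and> R rA = real (out_base + f) \<and> R rAcc = 0 \<and> R rCnt = real m)
      (sum_code rRowBig) (m * 5) (?Q s) (\<lambda>i R. ?F i R \<and> R rAcc = (\<Sum>r<m. s (r * m)))"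
  proof (rule valid_sum[where F = ?F and d = "m * stride" and a = "\<lambda>i. out_base + f" and
        h = "\<lambda>i r. s (r * m)", OF m])
    show "?F i R \<Longrightarrow> R rRowBig = real (m * stride) \<and> R rOne = 1" for i R
      by (rule F(2))
    show "?F i R \<Longrightarrow> r \<in> {rC, rAcc, rA, rCnt} \<Longrightarrow> ?F i (R(r := b))" for i R r b
      by (rule F_upd)
    fix M i j assume M: "?Q s M" and i: "i < ?N" and j: "j < m"
    have "j * m < ?N"
      using j m by simp
    with M have "M (cell f (j * m)) = s (j * m)"
      by blast
    moreover have "cell f (j * m) = out_base + f + j * (m * stride)"
      by (simp add: cell_def algebra_simps)
    ultimately show "M (out_base + f + j * (m * stride)) = s (j * m)"
      by simp
  qed simp
  have 8: "valid ?N (?Q s) (\<lambda>i R. ?F i R \<and> R rAcc = (\<Sum>r<m. s (r * m)))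
      (Block [Op Sub rAcc rZero rAcc]) 1 (?Q s) (\<lambda>i R. ?F i R \<and> R rAcc = weight_sum l (u, v))"
    by (rule valid_Block) (auto simp: params_def weight_sum_def sum)
  have 9: "valid ?N (?Q s) (\<lambda>i R. ?F i R \<and> R rAcc = weight_sum l (u, v))
      (Block [Store rCell rAcc]) 1 (?Q (\<lambda>_. weight_sum l (u, v))) (\<lambda>i R. ?F i R \<and> R rAcc = weight_sum l (u, v))"
    by (rule valid_weaken[OF store[of "\<lambda>i R. ?F i R \<and> R rAcc = weight_sum l (u, v)" rAcc "\<lambda>_. weight_sum l (u, v)"]]) auto
  have 10: "valid ?N (?Q (\<lambda>_. weight_sum l (u, v))) (\<lambda>i R. ?F i R \<and> R rAcc = weight_sum l (u, v))
      (Block [Op Sub rV rV rOne]) 1 (?Q (\<lambda>_. weight_sum l (u, v)))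
      (\<lambda>i R. params i R \<and> R rU = real u \<and> R rV = real (v - 1))"
    using v by (intro valid_Block) (auto simp: params_def of_nat_diff)
  \<comment> \<open>Only the copy of processor 0 counts: \<open>cell f 0\<close> is the output
    address.\<close>
  have finished: "sums_in l (Suc n) M" if M: "?Q (\<lambda>_. weight_sum l (u, v)) M" for M
  proof -
    have "M (cell f 0) = weight_sum l (u, v)"
      using M m by (simp add: Suc_le_eq)
    moreover have "pixel k f = (u, v)"
    proof -
      have "v - 1 < k"
        using v by auto
      from pixel_flat[OF this, of "u - 1"] u v show ?thesis
        by (simp add: f_def)
    qed
    ultimately have "M (out_base + f) = weight_sum l (pixel k f)"
      by (simp add: cell_def)
    moreover have "k * k \<le> f' + Suc n \<longleftrightarrow> k * k \<le> f' + n \<or> f' = f" for f'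
      using n by (auto simp: f_def)
    ultimately show ?thesis
      using M by (auto simp: sums_in_def)
  qed
  note seq = valid_Seq[OF 1 valid_Seq[OF 2 valid_Seq[OF 3 valid_Seq[OF 4
    valid_Seq[OF 5 valid_Seq[OF 6 valid_Seq[OF 7 valid_Seq[OF 8 valid_Seq[OF 9 10]]]]]]]]]
  show ?thesis
    unfolding weight_code_def
    by (rule valid_weaken[OF seq]) (auto simp: finished)
qed

lemma valid_weights:
  "valid (m * m) (lam_in l) params weights_code (5 + k * (k * (29 + 10 * m) + 3))
    (\<lambda>M. lam_in l M \<and> (\<forall>f<k * k. M (out_base + f) = weight_gradient m k l x (pixel k f))) params"
proof -
  let ?N = "m * m"
  let ?P = "\<lambda>j i R. params i R \<and> R rU = real (k - j)"
  let ?cell = "cell (k * k - 1)"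
  have kk: "k * k \<ge> 1"
    using k by simp
  have 1: "valid ?N (lam_in l) params (Block [Op Add rU rK rZero]) 1 (lam_in l) (?P 0)"
    by (rule valid_Block) (auto simp: params_def)
  have 2: "valid ?N (sums_in l (0 * k)) (?P 0)
      (Loop (Block [Op Add rV rK rZero] ;; Loop weight_code rV ;; Block [Op Sub rU rU rOne]) rU)
      (k * ((k * (29 + 10 * m) + 2) + 1)) (sums_in l (k * k)) (?P k)"
  proof (rule valid_Loop[where Q = "\<lambda>j. sums_in l (j * k)" and P = ?P])
    fix j assume j: "j < k"
    let ?P1 = "\<lambda>j' i R. params i R \<and> R rU = real (k - j) \<and> R rV = real (k - j')"
    have a: "valid ?N (sums_in l (j * k)) (?P j) (Block [Op Add rV rK rZero]) 1 (sums_in l (j * k + 0)) (?P1 0)"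
      by (simp, rule valid_Block) (auto simp: params_def)
    have b: "valid ?N (sums_in l (j * k + 0)) (?P1 0) (Loop weight_code rV) (k * ((28 + 10 * m) + 1))
        (sums_in l (j * k + k)) (?P1 k)"
    proof (rule valid_Loop[where Q = "\<lambda>j'. sums_in l (j * k + j')" and P = ?P1])
      fix j' assume j': "j' < k"
      obtain b where b: "k = j' + Suc b"
        using j' less_imp_Suc_add by auto
      \<comment> \<open>The counters go down, so the finished entries form a suffix in row-major
        order: the index of the current entry, plus the \<open>j * k + j'\<close> entries behind it,
        plus 1, is \<open>k * k\<close>.\<close>
      have "(k - j - 1) * k + (k - j' - 1) + Suc (j * k + j') = (k - j - 1 + j) * k + k"
        using b by (simp add: add_mult_distrib)
      also have "\<dots> = k * k"
      proof -
        have "Suc (k - j - 1 + j) = k"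
          using j by simp
        then show ?thesis
          by (metis add.commute mult_Suc)
      qed
      finally have "valid ?N (sums_in l (j * k + j')) (?P1 j') weight_code (28 + 10 * m)
          (sums_in l (Suc (j * k + j'))) (\<lambda>i R. params i R \<and> R rU = real (k - j) \<and> R rV = real (k - j' - 1))"
        using j j' by (intro valid_weight) auto
      then show "valid ?N (sums_in l (j * k + j')) (?P1 j') weight_code (28 + 10 * m)
          (sums_in l (j * k + Suc j')) (?P1 (Suc j'))"
        by simp
    qed (use k in auto)
    have c: "valid ?N (sums_in l (j * k + k)) (?P1 k) (Block [Op Sub rU rU rOne]) 1
        (sums_in l (j * k + k)) (?P (Suc j))"
      using j by (intro valid_Block) (auto simp: params_def of_nat_diff)
    show "valid ?N (sums_in l (j * k)) (?P j)
        (Block [Op Add rV rK rZero] ;; Loop weight_code rV ;; Block [Op Sub rU rU rOne])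
        (k * (29 + 10 * m) + 2) (sums_in l (Suc j * k)) (?P (Suc j))"
      by (rule valid_weaken[OF valid_Seq[OF a valid_Seq[OF b c]]]) (simp_all add: add.commute)
  qed (use k in auto)
  \<comment> \<open>The fixed entry is the last one in row-major order, with index
    \<open>k * k - 1\<close>.\<close>
  have 3: "valid ?N (sums_in l (k * k)) (?P k)
      (Block [Op Mul rA rK rK, Op Sub rA rA rOne, Op Add rA rA rOutOwn]) 3
      (sums_in l (k * k)) (\<lambda>i R. params i R \<and> R rA = real (?cell i))"
  proof (rule valid_Block)
    fix M i R assume "?P k i R"
    moreover have "real (?cell i) = real k * real k - 1 + real (i * stride + out_base)" for i
    proof -
      have "real (k * k - 1) = real k * real k - 1"
        using kk by (simp add: of_nat_diff)
      then show ?thesis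
        by (simp add: cell_def del: of_nat_diff)
    qed
    ultimately show "block_ok M i [Op Mul rA rK rK, Op Sub rA rA rOne, Op Add rA rA rOutOwn] R \<and>
        params i (exec_block M i [Op Mul rA rK rK, Op Sub rA rA rOne, Op Add rA rA rOutOwn] R) \<and>
        exec_block M i [Op Mul rA rK rK, Op Sub rA rA rOne, Op Add rA rA rOutOwn] R rA = real (?cell i)"
      by (simp add: params_def del: of_nat_add)
  qed simp
  have 4: "valid ?N (sums_in l (k * k)) (\<lambda>i R. params i R \<and> R rA = real (?cell i)) (Block [Store rA rZero]) 1
      (\<lambda>M. lam_in l M \<and> (\<forall>f<k * k. M (out_base + f) = weight_gradient m k l x (pixel k f)))
      (\<lambda>i R. params i R \<and> R rA = real (?cell i))"
  proof (rule valid_Store[where ad = ?cell and val = "\<lambda>_. 0"])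
    fix M M' assume M: "sums_in l (k * k) M" "\<forall>i<?N. M' (?cell i) = 0"
      "\<forall>a. a \<notin> ?cell ` {..<?N} \<longrightarrow> M' a = M a"
    have "M' a = M a" if "a < out_base" for a
      using that M(3) cell_notin[of a "k * k - 1" ?N] by auto
    then have "lam_in l M'"
      using lam_in_cong M(1) unfolding sums_in_def by blast
    moreover have "M' (out_base + f) = weight_gradient m k l x (pixel k f)" if f: "f < k * k" for f
    proof (cases "f = k * k - 1")
      case True
      have "k * k - 1 = (k - 1) * k + (k - 1)"
        using k by (cases k) auto
      then have "pixel k f = (k, k)"
        using True k pixel_flat[of "k - 1" k "k - 1"] by simp
      then show ?thesis
        using True M(2) m by (auto simp: cell_def weight_gradient_def dest: spec[of _ 0])
    next
      case False
      then have "M' (out_base + f) = M (out_base + f)"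
        using M(3) cell_notin[of "out_base + f" "k * k - 1" ?N] f by auto
      also have "\<dots> = weight_sum l (pixel k f)"
        using M(1) f by (simp add: sums_in_def)
      also have "pixel k f \<noteq> (k, k)"
      proof
        assume "pixel k f = (k, k)"
        then have "f div k = k - 1" "f mod k = k - 1"
          by (auto simp: pixel_def)
        then have "f = (k - 1) * k + (k - 1)"
          by (metis div_mult_mod_eq)
        then show False
          using False k by (cases k) auto
      qed
      then have "weight_sum l (pixel k f) = weight_gradient m k l x (pixel k f)"
        using weight_gradient_shifted[OF pixel_square[OF f]] by (simp add: weight_sum_def)
      finally show ?thesis .
    qed
    ultimately show "lam_in l M' \<and> (\<forall>f<k * k. M' (out_base + f) = weight_gradient m k l x (pixel k f))"
      by blast
  qed (auto simp: inj_cell params_def)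
  \<comment> \<open>With no finished entry \<open>sums_in\<close> says no more than
    \<open>lam_in\<close>; \<open>0 * k\<close> is the shape of the loop invariant at round
    0.\<close>
  have "valid ?N (lam_in l) params (Block [Op Add rU rK rZero]) 1 (sums_in l (0 * k)) (?P 0)"
    by (rule valid_weaken[OF 1]) (auto simp: sums_in_def)
  note seq = valid_Seq[OF this valid_Seq[OF 2 valid_Seq[OF 3 4]]]
  show ?thesis
    unfolding weights_code_def
    by (rule valid_weaken[OF seq]) (simp_all add: distrib_left)
qed

lemma valid_gradients:
  "valid (m * m) (\<lambda>M. (lam_in (jacobi m k W g 0) M \<and> kernel_in M) \<and> input_in M) (\<lambda>i R. R = (\<lambda>_. 0))
    gradients_code (141 * (m * k\<^sup>2))
    (\<lambda>M. lam_in (adjoint_solution m k W g) M \<and>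
      (\<forall>f<k * k. M (out_base + f) = weight_gradient m k (adjoint_solution m k W g) x (pixel k f))) params"
proof -
  let ?Q = "\<lambda>M. lam_in (jacobi m k W g 0) M \<and> kernel_in M"
  have "5 + m * 5 + (24 + (2 * m * (k * (k * 21 + 3) + 6) + (5 + k * (k * (29 + 10 * m) + 3)))) =
      34 + 17 * m + 42 * (m * k * k) + 6 * (m * k) + 29 * (k * k) + 10 * (m * k * k) + 3 * k"
    by (simp add: algebra_simps)
  \<comment> \<open>Every monomial is at most \<open>m * k * k\<close>, and the coefficients 34, 17,
    42, 6, 29, 10 and 3 add up to 141.\<close>
  also have "\<dots> \<le> 141 * (m * k\<^sup>2)"
  proof -
    have "1 \<le> m * k * k" "m \<le> m * k * k" "m * k \<le> m * k * k" "k * k \<le> m * k * k" "k \<le> m * k * k"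
      using m k by simp_all
    moreover have "m * k\<^sup>2 = m * k * k"
      by (simp add: power2_eq_square)
    ultimately show ?thesis
      by linarith
  qed
  finally have time: "5 + m * 5 + (24 + (2 * m * (k * (k * 21 + 3) + 6) + (5 + k * (k * (29 + 10 * m) + 3))))
      \<le> 141 * (m * k\<^sup>2)" .
  have jacobi: "valid (m * m) (\<lambda>M. ?Q M \<and> input_in M) (\<lambda>i R. params i R \<and> R rCnt = real (2 * m))
      jacobi_code (2 * m * (k * (k * 21 + 3) + 6)) (lam_in (adjoint_solution m k W g)) params"
    by (rule valid_weaken[OF valid_jacobi]) auto
  show ?thesis
    unfolding gradients_code_def
    by (rule valid_weaken[OF valid_Seq[OF valid_decode valid_Seq[OF valid_setup valid_Seq[OF jacobi valid_weights]]]])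
      (use time in auto)
qed

end

section \<open>Input encoding, output decoding and the final assembly\<close>

lemma indices_nth: "i < n * n \<Longrightarrow> indices n ! i = pixel n i"
  by (cases "n = 0") (auto simp: indices_def pixel_def product_nth less_mult_imp_div_less simp del: upt_Suc)

lemma length_indices: "length (indices n) = n * n"
  by (simp add: indices_def)

lemma (in problem) input_memory:
  defines "M \<equiv> input_memory m k W x g"
  shows "lam_in (jacobi m k W g 0) M" "kernel_in M" "input_in M"
proof -
  have length: "length (input_list m k W x g) = lam_base"
    by (simp add: input_list_def length_indices lam_base_def)
  have M: "M a = input_list m k W x g ! a" if "a < lam_base" for a
    using that by (simp add: M_def input_memory_def length)
  have nth: "input_list m k W x g ! (2 + i) =
      (map W (indices k) @ map x (indices m) @ map g (indices m)) ! i" for i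
    by (simp add: input_list_def)
  show "lam_in (jacobi m k W g 0) M"
    by (simp add: lam_in_def M_def input_memory_def length)
  show "kernel_in M"
    unfolding kernel_in_def
  proof (intro ballI)
    fix u v assume u: "u \<in> {1..k}" and v: "v \<in> {1..k}"
    define f where "f = (u - 1) * k + (v - 1)"
    have f: "f < k * k"
      unfolding f_def using u v by (intro flat_less) auto
    have "v - 1 < k"
      using v by auto
    from pixel_flat[OF this, of "u - 1"] u v have "pixel k f = (u, v)"
      by (simp add: f_def)
    then have "M (2 + f) = W (u, v)"
      using f by (subst M) (simp_all only: nth lam_base_def, simp_all add: nth_append length_indices indices_nth)
    then show "M ((u - 1) * k + (v - 1) + 2) = W (u, v)"
      by (simp only: f_def add.commute)
  qed
  have "M (2 + (k * k + i)) = x (pixel m i)" if "i < m * m" for i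
    using that by (subst M) (simp_all only: nth lam_base_def, simp_all add: nth_append length_indices indices_nth)
  moreover have "M (2 + (k * k + m * m + i)) = g (pixel m i)" if "i < m * m" for i
    using that by (subst M) (simp_all only: nth lam_base_def, simp_all add: nth_append length_indices indices_nth)
  moreover have "M 0 = real m" "M 1 = real k"
    by (simp_all add: M lam_base_def input_list_def)
  ultimately show "input_in M"
    by (simp add: input_in_def add.assoc)
qed

lemma has_gradient_cong:
  "(\<And>i. i \<in> I \<Longrightarrow> g i = g' i) \<Longrightarrow> has_gradient I f g x \<longleftrightarrow> has_gradient I f g' x"
  by (simp add: has_gradient_def)

lemma read_array_eq:
  assumes "\<And>i. i < n * n \<Longrightarrow> M (base + i) = h (pixel n i)" "p \<in> square n"
  shows "read_array base n M p = h p"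
proof -
  have p: "fst p - 1 < n" "snd p - 1 < n" "fst p \<ge> 1" "snd p \<ge> 1"
    using assms(2) by (auto simp: square_def)
  have "M (base + ((fst p - 1) * n + (snd p - 1))) = h p"
    using assms(1)[OF flat_less[OF p(1,2)]] pixel_flat[OF p(2), of "fst p - 1"] p(3,4) by simp
  then show ?thesis
    using assms(2) by (simp only: read_array_def restrict_apply if_True add.assoc)
qed

theorem mainTheorem1:
  shows "\<exists>(prog :: instr list) (procs :: nat \<Rightarrow> nat \<Rightarrow> nat) (C :: nat).
    \<forall>m k :: nat. m \<ge> 1 \<longrightarrow> k \<ge> 1 \<longrightarrow>
      (\<forall>(W :: nat \<times> nat \<Rightarrow> real) (y :: nat \<times> nat \<Rightarrow> real) (x :: nat \<times> nat \<Rightarrow> real)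
        (L :: (nat \<times> nat \<Rightarrow> real) \<Rightarrow> real) (g :: nat \<times> nat \<Rightarrow> real).
        W \<in> arrays k \<longrightarrow> W (k, k) = 1 \<longrightarrow> y \<in> arrays m \<longrightarrow> x = inv_conv m k W y \<longrightarrow>
        (\<forall>z \<in> arrays m. \<exists>d. has_gradient (square m) L d z) \<longrightarrow>
        has_gradient (square m) L g x \<longrightarrow>
        (\<exists>t M. t \<le> C * (m * k\<^sup>2) \<and>
           runs_to prog (procs m k) (input_memory m k W x g) t M \<and>
           has_gradient (square m) (\<lambda>y'. L (inv_conv m k W y')) (output_y m k M) y \<and>
           has_gradient (square k) (\<lambda>W'. L (inv_conv m k W' y)) (output_W m k M) W))"
proof (rule exI[of _ "compile 0 gradients_code"], rule exI[of _ "\<lambda>m k. m * m"], rule exI[of _ 141], intro allI impI)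
  fix m k :: nat and W y x g :: "nat \<times> nat \<Rightarrow> real" and L :: "(nat \<times> nat \<Rightarrow> real) \<Rightarrow> real"
  assume mk: "m \<ge> 1" "k \<ge> 1" and W: "W (k, k) = 1" and y: "y \<in> arrays m" and x: "x = inv_conv m k W y"
    and L: "has_gradient (square m) L g x"
  interpret problem m k W x g
    using mk W by unfold_locales
  let ?l = "adjoint_solution m k W g"
  obtain t M where t: "t \<le> 141 * (m * k\<^sup>2)"
    and run: "runs_to (compile 0 gradients_code) (m * m) (input_memory m k W x g) t M"
    and lam: "lam_in ?l M"
    and weights: "\<forall>f<k * k. M (out_base + f) = weight_gradient m k ?l x (pixel k f)"
    using valid_runs_to[OF valid_gradients, of "input_memory m k W x g"] input_memory by blast
  have "output_y m k M p = ?l p" if "p \<in> square m" for p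
    unfolding output_y_def
    by (rule read_array_eq) (use lam that in \<open>simp_all add: lam_in_def lam_base_def power2_eq_square\<close>)
  then have "has_gradient (square m) (\<lambda>y'. L (inv_conv m k W y')) (output_y m k M) y"
    using has_gradient_input[OF y, of L g k W] L x by (simp add: has_gradient_cong[of _ "output_y m k M" ?l])
  moreover have "output_W m k M e = weight_gradient m k ?l x e" if "e \<in> square k" for e
  proof -
    have "2 + k\<^sup>2 + 3 * m\<^sup>2 = out_base"
      by (simp add: out_base_def lam_base_def power2_eq_square)
    then show ?thesis
      unfolding output_W_def using weights that by (simp add: read_array_eq)
  qed
  then have "has_gradient (square k) (\<lambda>W'. L (inv_conv m k W' y)) (output_W m k M) W"
    using has_gradient_weights[OF y x L]
    by (simp add: has_gradient_cong[of _ "output_W m k M" "weight_gradient m k ?l x"])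
  ultimately show "\<exists>t M. t \<le> 141 * (m * k\<^sup>2) \<and>
      runs_to (compile 0 gradients_code) (m * m) (input_memory m k W x g) t M \<and>
      has_gradient (square m) (\<lambda>y'. L (inv_conv m k W y')) (output_y m k M) y \<and>
      has_gradient (square k) (\<lambda>W'. L (inv_conv m k W' y)) (output_W m k M) W"
    using t run by blast
qed

end
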